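(* Consider the Linking-Unlinking Game played on a shadow of a 2-component link. (1) If the shadow contains zero non-self-intersections, then the Unlinker wins (however the game is played and whoever moves first). (2) If the shadow contains a nonzero number of non-self-intersections and an even number of self-intersections, then the Linker has a winning strategy when playing second. (3) If the shadow contains a nonzero number of non-self-intersections and an odd number of self-intersections, then the Linker has a winning strategy when playing first.
   Context: A link shadow is a projection of a link to the plane $\mathbb{R}^2$ in which all crossings are transverse double points, with no over/under information. Resolving a crossing means choosing which of its two strands is the overstrand; each crossing has two possible resolutions. A link diagram is a link shadow all of whose crossings have been resolved. Two link diagrams are equivalent if they are related by a finite sequence of Reidemeister moves and planar isotopies. A link diagram is splittable if it is equivalent to a diagram in which one or more components lie entirely inside a circle in the plane and the other components lie entirely outside it; otherwise it is unsplittable. A crossing is a self-intersection (SI) if the two strands meeting there belong to the same component of the link, and a non-self-intersection (NSI) otherwise. The Linking-Unlinking Game is a two-player game played on the shadow of a 2-component link. Players alternately choose an unresolved crossing and resolve it, until all crossings are resolved and a 2-component link diagram is formed. One player, the Linker, wins if the resulting diagram is unsplittable; the other player, the Unlinker, wins if it is splittable. Either of the two players may move first. A player has a winning strategy if they can force a win regardless of the opponent's moves. *)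

theory Defs
  imports "HOL-Analysis.Analysis"
begin

section \<open>Link shadows\<close>

text \<open>
  The plane is \<^typ>\<open>complex\<close>, regarded as a real vector space.  A component is a closed immersed
  \<open>C\<^sup>1\<close> curve, parametrised over the reals with period 1.  A family of components is a list, and the
  points of the abstract (not yet projected) link are the pairs \<open>(i, t)\<close> of a component index and a
  parameter in \<open>[0, 1)\<close>.
\<close>

type_synonym lpoint = "nat \<times> real"
type_synonym shadow = "(real \<Rightarrow> complex) list"

definition immersed_closed_curve :: "(real \<Rightarrow> complex) \<Rightarrow> bool" where
  "immersed_closed_curve g \<longleftrightarrow>
     (\<forall>t. g (t + 1) = g t) \<and> g C1_differentiable_on UNIV \<and>
     (\<forall>t. vector_derivative g (at t) \<noteq> 0)"

definition lpoints :: "shadow \<Rightarrow> lpoint set" where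
  "lpoints S = {..<length S} \<times> {0..<1}"

definition proj :: "shadow \<Rightarrow> lpoint \<Rightarrow> complex" where
  "proj S x = (S ! fst x) (snd x)"

definition tangent :: "shadow \<Rightarrow> lpoint \<Rightarrow> complex" where
  "tangent S x = vector_derivative (S ! fst x) (at (snd x))"

definition strands :: "shadow \<Rightarrow> complex \<Rightarrow> lpoint set" where
  "strands S p = {x \<in> lpoints S. proj S x = p}"

definition crossings :: "shadow \<Rightarrow> complex set" where
  "crossings S = {p. \<exists>x\<in>strands S p. \<exists>y\<in>strands S p. x \<noteq> y}"

definition self_intersections :: "shadow \<Rightarrow> complex set" where
  "self_intersections S = {p. \<exists>x\<in>strands S p. \<exists>y\<in>strands S p. x \<noteq> y \<and> fst x = fst y}"

definition non_self_intersections :: "shadow \<Rightarrow> complex set" where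
  "non_self_intersections S = {p. \<exists>x\<in>strands S p. \<exists>y\<in>strands S p. fst x \<noteq> fst y}"

text \<open>
  Every such family is the projection of a link in space: lift the curves so that the two strands
  at each double point get different heights.
\<close>

definition link_shadow :: "shadow \<Rightarrow> bool" where
  "link_shadow S \<longleftrightarrow>
     (\<forall>g\<in>set S. immersed_closed_curve g) \<and>
     finite (crossings S) \<and>
     (\<forall>p. finite (strands S p) \<and> card (strands S p) \<le> 2) \<and>
     (\<forall>p. \<forall>x\<in>strands S p. \<forall>y\<in>strands S p. x \<noteq> y \<longrightarrow> tangent S x \<notin> span {tangent S y})"


section \<open>Link diagrams\<close>

text \<open>A (partial) resolution assigns to a crossing the strand that passes over there.\<close>

type_synonym resolution = "complex \<rightharpoonup> lpoint"
type_synonym diagram = "shadow \<times> resolution"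

definition link_diagram :: "diagram \<Rightarrow> bool" where
  "link_diagram D \<longleftrightarrow>
     link_shadow (fst D) \<and> dom (snd D) = crossings (fst D) \<and>
     (\<forall>p x. snd D p = Some x \<longrightarrow> x \<in> strands (fst D) p)"

text \<open>
  A diagram is a picture, without numbering, base points or orientations.  Two diagrams in the
  above sense show the same picture if they differ by a permutation \<open>\<pi>\<close> of the components and
  (possibly orientation-reversing) changes of parameter \<open>h i\<close> of the circle.
\<close>

definition circle_reparam :: "(real \<Rightarrow> real) \<Rightarrow> bool" where
  "circle_reparam h \<longleftrightarrow>
     h C1_differentiable_on UNIV \<and> (\<forall>t. vector_derivative h (at t) \<noteq> 0) \<and>
     ((\<forall>t. h (t + 1) = h t + 1) \<or> (\<forall>t. h (t + 1) = h t - 1))"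

definition same_picture :: "diagram \<Rightarrow> diagram \<Rightarrow> bool" where
  "same_picture D D' \<longleftrightarrow>
     length (fst D') = length (fst D) \<and>
     (\<exists>\<pi> h. bij_betw \<pi> {..<length (fst D)} {..<length (fst D)} \<and>
        (\<forall>i<length (fst D). circle_reparam (h i) \<and> fst D' ! i = (fst D ! \<pi> i) \<circ> h i) \<and>
        (\<forall>p. snd D p = map_option (\<lambda>(i, t). (\<pi> i, frac (h i t))) (snd D' p)))"


section \<open>Planar isotopies\<close>

definition ambient_isotopy :: "(real \<Rightarrow> complex \<Rightarrow> complex) \<Rightarrow> bool" where
  "ambient_isotopy H \<longleftrightarrow>
     (\<forall>z. H 0 z = z) \<and> (\<forall>t\<in>{0..1}. bij (H t)) \<and>
     continuous_on ({0..1} \<times> UNIV) (\<lambda>(t, z). H t z) \<and>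
     (\<exists>H' :: real \<Rightarrow> complex \<Rightarrow> complex \<Rightarrow>\<^sub>L complex.
        continuous_on ({0..1} \<times> UNIV) (\<lambda>(t, z). H' t z) \<and>
        (\<forall>t\<in>{0..1}. \<forall>z. (H t has_derivative blinfun_apply (H' t z)) (at z) \<and>
                          inj (blinfun_apply (H' t z))))"

definition planar_isotopic :: "diagram \<Rightarrow> diagram \<Rightarrow> bool" where
  "planar_isotopic D D' \<longleftrightarrow>
     (\<exists>H. ambient_isotopy H \<and> fst D' = map (\<lambda>g. H 1 \<circ> g) (fst D) \<and>
          (\<forall>p. snd D' (H 1 p) = snd D p))"


section \<open>Reidemeister moves\<close>

text \<open>
  A move replaces the part of a diagram inside a disc.  An arc \<open>(i, a, b)\<close> is the piece of component
  \<open>i\<close> with parameters from \<open>a\<close> to \<open>b\<close>; here \<open>a\<close> and \<open>b\<close> are any reals, so that an arc may run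
  through the base point of its component.
\<close>

type_synonym arc = "nat \<times> real \<times> real"

fun arc_points :: "arc \<Rightarrow> lpoint set" where
  "arc_points (i, a, b) = (\<lambda>t. (i, frac t)) ` {a..b}"

fun proper_arc :: "shadow \<Rightarrow> complex \<Rightarrow> real \<Rightarrow> arc \<Rightarrow> bool" where
  "proper_arc S c r (i, a, b) \<longleftrightarrow>
     i < length S \<and> a < b \<and> b < a + 1 \<and>
     (S ! i) a \<in> sphere c r \<and> (S ! i) b \<in> sphere c r \<and> (\<forall>t\<in>{a<..<b}. (S ! i) t \<in> ball c r)"

text \<open>
  The part of \<open>S\<close> in the disc consists of the disjoint arcs \<open>As\<close>, running from boundary to
  boundary, with no crossing on the boundary.
\<close>

definition tangle :: "shadow \<Rightarrow> complex \<Rightarrow> real \<Rightarrow> arc list \<Rightarrow> bool" where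
  "tangle S c r As \<longleftrightarrow>
     0 < r \<and> crossings S \<inter> sphere c r = {} \<and>
     (\<forall>A\<in>set As. proper_arc S c r A) \<and>
     disjoint_family_on (\<lambda>k. arc_points (As ! k)) {..<length As} \<and>
     {x \<in> lpoints S. proj S x \<in> cball c r} = (\<Union>A\<in>set As. arc_points A)"

text \<open>
  Both diagrams consist of the arcs \<open>As\<close> in the disc and they coincide outside.  Using the same
  parameter intervals and round discs is no restriction, in view of \<^const>\<open>same_picture\<close> and
  \<^const>\<open>planar_isotopic\<close>.
\<close>

definition local_change :: "complex \<Rightarrow> real \<Rightarrow> arc list \<Rightarrow> diagram \<Rightarrow> diagram \<Rightarrow> bool" where
  "local_change c r As D D' \<longleftrightarrow>
     tangle (fst D) c r As \<and> tangle (fst D') c r As \<and>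
     length (fst D) = length (fst D') \<and>
     (\<forall>x \<in> lpoints (fst D) - (\<Union>A\<in>set As. arc_points A). proj (fst D) x = proj (fst D') x) \<and>
     (\<forall>p. p \<notin> cball c r \<longrightarrow> snd D p = snd D' p)"

definition meets :: "shadow \<Rightarrow> arc \<Rightarrow> arc \<Rightarrow> complex set" where
  "meets S A B =
     {p. \<exists>x\<in>arc_points A. \<exists>y\<in>arc_points B. x \<noteq> y \<and> proj S x = p \<and> proj S y = p}"

definition lies_over :: "diagram \<Rightarrow> arc \<Rightarrow> arc \<Rightarrow> bool" where
  "lies_over D A B \<longleftrightarrow> (\<forall>p\<in>meets (fst D) A B. \<exists>x\<in>arc_points A. snd D p = Some x)"

definition simple_arcs :: "shadow \<Rightarrow> arc list \<Rightarrow> bool" where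
  "simple_arcs S As \<longleftrightarrow> (\<forall>A\<in>set As. meets S A A = {})"

text \<open>First move: a simple arc gets a kink, that is, one self-crossing, resolved either way.\<close>

definition reidemeister1 :: "diagram \<Rightarrow> diagram \<Rightarrow> bool" where
  "reidemeister1 D D' \<longleftrightarrow>
     (\<exists>c r A. local_change c r [A] D D' \<and>
        simple_arcs (fst D) [A] \<and> card (meets (fst D') A A) = 1)"

text \<open>Second move: of two disjoint simple arcs, one is pushed over the other, making two crossings.\<close>

definition reidemeister2 :: "diagram \<Rightarrow> diagram \<Rightarrow> bool" where
  "reidemeister2 D D' \<longleftrightarrow>
     (\<exists>c r A B. local_change c r [A, B] D D' \<and>
        simple_arcs (fst D) [A, B] \<and> meets (fst D) A B = {} \<and>
        simple_arcs (fst D') [A, B] \<and> card (meets (fst D') A B) = 2 \<and> lies_over D' A B)"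

text \<open>
  Third move: three simple arcs, top, middle and bottom, cross pairwise once, and one of them is
  slid past the crossing of the other two.  The slide is what reverses the order in which the top
  arc meets the other two arcs.
\<close>

definition layered_triangle :: "diagram \<Rightarrow> arc \<Rightarrow> arc \<Rightarrow> arc \<Rightarrow> bool" where
  "layered_triangle D A B C \<longleftrightarrow>
     simple_arcs (fst D) [A, B, C] \<and>
     card (meets (fst D) A B) = 1 \<and> card (meets (fst D) A C) = 1 \<and> card (meets (fst D) B C) = 1 \<and>
     lies_over D A B \<and> lies_over D A C \<and> lies_over D B C"

fun meets_first :: "shadow \<Rightarrow> arc \<Rightarrow> arc \<Rightarrow> arc \<Rightarrow> bool" where
  "meets_first S (i, a, b) B C \<longleftrightarrow>
     (\<exists>s t. a \<le> s \<and> s < t \<and> t \<le> b \<and>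
        (S ! i) s \<in> proj S ` arc_points B \<and> (S ! i) t \<in> proj S ` arc_points C)"

definition reidemeister3 :: "diagram \<Rightarrow> diagram \<Rightarrow> bool" where
  "reidemeister3 D D' \<longleftrightarrow>
     (\<exists>c r A B C. local_change c r [A, B, C] D D' \<and>
        layered_triangle D A B C \<and> layered_triangle D' A B C \<and>
        meets_first (fst D) A B C \<noteq> meets_first (fst D') A B C)"


section \<open>Equivalence and splittability\<close>

definition elementary_step :: "diagram \<Rightarrow> diagram \<Rightarrow> bool" where
  "elementary_step D D' \<longleftrightarrow>
     link_diagram D \<and> link_diagram D' \<and>
     (same_picture D D' \<or> planar_isotopic D D' \<or>
      reidemeister1 D D' \<or> reidemeister2 D D' \<or> reidemeister3 D D')"

definition diagram_equiv :: "diagram \<Rightarrow> diagram \<Rightarrow> bool" where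
  "diagram_equiv = equivclp elementary_step"

text \<open>At least one component must lie on either side of the circle.\<close>

definition split_by_circle :: "shadow \<Rightarrow> bool" where
  "split_by_circle S \<longleftrightarrow>
     (\<exists>c r I. 0 < r \<and> I \<noteq> {} \<and> I \<subset> {..<length S} \<and>
        (\<forall>i\<in>I. range (S ! i) \<subseteq> ball c r) \<and>
        (\<forall>i\<in>{..<length S} - I. range (S ! i) \<subseteq> - cball c r))"

definition splittable :: "diagram \<Rightarrow> bool" where
  "splittable D \<longleftrightarrow> (\<exists>D'. diagram_equiv D D' \<and> split_by_circle (fst D'))"


section \<open>The Linking-Unlinking Game\<close>

datatype player = Linker | Unlinker

text \<open>
  A move names a crossing and the strand that shall pass over.  A play lists the moves made so
  far in chronological order; which player made them depends on who moves first.
\<close>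

type_synonym move = "complex \<times> lpoint"

definition legal_play :: "shadow \<Rightarrow> move list \<Rightarrow> bool" where
  "legal_play S ms \<longleftrightarrow>
     distinct (map fst ms) \<and> (\<forall>(p, x)\<in>set ms. p \<in> crossings S \<and> x \<in> strands S p)"

definition complete_play :: "shadow \<Rightarrow> move list \<Rightarrow> bool" where
  "complete_play S ms \<longleftrightarrow> legal_play S ms \<and> fst ` set ms = crossings S"

definition final_diagram :: "shadow \<Rightarrow> move list \<Rightarrow> diagram" where
  "final_diagram S ms = (S, map_of ms)"

fun wins :: "player \<Rightarrow> shadow \<Rightarrow> move list \<Rightarrow> bool" where
  "wins Linker S ms \<longleftrightarrow> \<not> splittable (final_diagram S ms)"
| "wins Unlinker S ms \<longleftrightarrow> splittable (final_diagram S ms)"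

fun opponent :: "player \<Rightarrow> player" where
  "opponent Linker = Unlinker"
| "opponent Unlinker = Linker"

definition to_move :: "player \<Rightarrow> nat \<Rightarrow> player" where
  "to_move first k = (if even k then first else opponent first)"

definition follows :: "player \<Rightarrow> player \<Rightarrow> (move list \<Rightarrow> move) \<Rightarrow> move list \<Rightarrow> bool" where
  "follows P first \<sigma> ms \<longleftrightarrow>
     (\<forall>k<length ms. to_move first k = P \<longrightarrow> ms ! k = \<sigma> (take k ms))"

text \<open>
  The strategy must supply a legal move whenever \<open>P\<close> is to move, and every complete play in which
  \<open>P\<close> follows it must be won by \<open>P\<close>.
\<close>

definition winning_strategy ::
  "player \<Rightarrow> player \<Rightarrow> shadow \<Rightarrow> (move list \<Rightarrow> move) \<Rightarrow> bool" where
  "winning_strategy P first S \<sigma> \<longleftrightarrow>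
     (\<forall>ms. legal_play S ms \<and> \<not> complete_play S ms \<and> follows P first \<sigma> ms \<and>
           to_move first (length ms) = P \<longrightarrow> legal_play S (ms @ [\<sigma> ms])) \<and>
     (\<forall>ms. complete_play S ms \<and> follows P first \<sigma> ms \<longrightarrow> wins P S ms)"

end

theory Submission
  imports Defs "HOL-Complex_Analysis.Riemann_Mapping"
begin

text \<open>
  For \<open>i \<noteq> j\<close>, the parity of the number of crossings at which component \<open>i\<close> passes over component
  \<open>j\<close> is a diagram invariant (up to renumbering), because the second move adds two such crossings or
  none and the third move keeps their number.  It is even in a split diagram.  So the Linker wins by
  resolving the last non-self-intersection suitably, and gets to do so by always leaving an even
  number of unresolved crossings of either kind.  If the number of non-self-intersections is odd,
  one of the two parities is odd anyway (by the Jordan curve theorem this does not happen, but that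
  is not needed).

  Without non-self-intersections the two curves have disjoint images, so one of them lies in a
  simply connected open set that misses the other.  A radial contraction of the unit disc, transported
  by a Riemann map, shrinks this curve into a small round disc while the other curve stays put.  The
  bounding circle splits the diagram even if the disc lies in a bounded region of the other curve.
\<close>

section \<open>Parity of the crossings between two components\<close>

text \<open>Points are counted, not pairs of strands. In a link shadow at most two strands meet at a
  point, so for \<open>i \<noteq> j\<close> the strands \<open>x\<close> and \<open>y\<close> are
  determined by \<open>p\<close>.\<close>

definition passes_over :: "diagram \<Rightarrow> nat \<Rightarrow> nat \<Rightarrow> complex set" where
  "passes_over D i j =
     {p. \<exists>x y. snd D p = Some x \<and> y \<in> strands (fst D) p \<and> fst x = i \<and> fst y = j}"

text \<open>For \<open>i \<noteq> j\<close> the count has the parity of the linking number of the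
  two components. Ranging over all ordered pairs makes the condition independent of the
  numbering.\<close>

definition evenly_linked :: "diagram \<Rightarrow> bool" where
  "evenly_linked D \<longleftrightarrow> (\<forall>i j. i \<noteq> j \<longrightarrow> even (card (passes_over D i j)))"

lemma strands_at_most_two:
  assumes "link_shadow S" "x \<in> strands S p" "y \<in> strands S p" "z \<in> strands S p" "x \<noteq> y"
  shows "z = x \<or> z = y"
proof (rule ccontr)
  assume "\<not> ?thesis"
  then have "card {x, y, z} = 3" using assms(5) by auto
  moreover have "card {x, y, z} \<le> card (strands S p)"
    using assms by (intro card_mono) (auto simp: link_shadow_def)
  moreover have "card (strands S p) \<le> 2" using assms(1) by (auto simp: link_shadow_def)
  ultimately show False by simp
qed

lemma finite_passes_over: "link_diagram D \<Longrightarrow> finite (passes_over D i j)"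
  by (rule finite_subset[of _ "dom (snd D)"])
     (auto simp: link_diagram_def link_shadow_def passes_over_def)

section \<open>Reparametrised circles and renumbered components\<close>

lemma periodic_int:
  assumes "\<And>t. g (t + 1) = (g t :: 'a)"
  shows "g (t + of_int n) = g (t :: real)"
proof -
  have nat: "g (t + real n) = g t" for n t
  proof (induction n)
    case (Suc n)
    have "g (t + real (Suc n)) = g ((t + real n) + 1)" by (simp add: algebra_simps)
    then show ?case using assms Suc by simp
  qed simp
  show ?thesis
  proof (cases "n \<ge> 0")
    case True
    then show ?thesis using nat[of t "nat n"] by simp
  next
    case False
    then show ?thesis using nat[of "t + of_int n" "nat (- n)"] by simp
  qed
qed

lemma periodic_frac:
  assumes "\<And>t. g (t + 1) = (g t :: 'a)"
  shows "g (frac t) = g (t :: real)"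
  using periodic_int[of g t "- \<lfloor>t\<rfloor>", OF assms] by (simp add: frac_def)

text \<open>Subtracting the linear part \<open>c * t\<close> leaves a periodic function, so
  \<open>h\<close> takes the values \<open>h 0 + c * n\<close> at the integers. These are unbounded
  both ways, and the intermediate value theorem does the rest.\<close>

lemma circle_reparam_surj:
  assumes "circle_reparam h"
  shows "surj h"
proof -
  have cont: "continuous_on UNIV h"
    using assms by (auto simp: circle_reparam_def intro: C1_differentiable_imp_continuous_on)
  obtain c :: real where c: "\<bar>c\<bar> = 1" and step: "\<And>t. h (t + 1) = h t + c"
  proof (cases "\<forall>t. h (t + 1) = h t + 1")
    case True
    then show ?thesis by (intro that[of 1]) auto
  next
    case False
    then have "\<forall>t. h (t + 1) = h t - 1" using assms by (auto simp: circle_reparam_def)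
    then show ?thesis by (intro that[of "- 1"]) auto
  qed
  define k where "k t = h t - c * t" for t
  have k: "k (t + of_int n) = k t" for t n
    by (rule periodic_int) (simp add: k_def step algebra_simps)
  have h_int: "h (of_int n) = h 0 + c * of_int n" for n
    using k[of 0 n] by (simp add: k_def)
  show ?thesis
    unfolding surj_def
  proof
    fix y
    obtain n :: int where n: "\<bar>y - h 0\<bar> \<le> of_int n"
      using ex_le_of_int by blast
    have n0: "0 \<le> n" using n by linarith
    have le: "- n \<le> n" using n0 by simp
    have "c = 1 \<or> c = - 1" using c by linarith
    then have "\<exists>x. h x = y"
    proof
      assume "c = 1"
      then have "h (of_int (- n)) \<le> y" "y \<le> h (of_int n)" using n h_int[of n] h_int[of "- n"] by auto
      then show ?thesis
        using IVT'[of h "of_int (- n)" y "of_int n"] le cont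
        by (metis continuous_on_subset of_int_le_iff subset_UNIV)
    next
      assume "c = - 1"
      then have "h (of_int n) \<le> y" "y \<le> h (of_int (- n))" using n h_int[of n] h_int[of "- n"] by auto
      then show ?thesis
        using IVT2'[of h "of_int n" y "of_int (- n)"] le cont
        by (metis continuous_on_subset of_int_le_iff subset_UNIV)
    qed
    then show "\<exists>x. y = h x" by blast
  qed
qed

lemma link_shadow_periodic:
  assumes "link_shadow S" "i < length S"
  shows "(S ! i) (t + 1) = (S ! i) t"
  using assms nth_mem by (fastforce simp: link_shadow_def immersed_closed_curve_def)

text \<open>\<open>\<pi>\<close> sends an index of \<open>D'\<close> to the index of the same curve
  in \<open>D\<close>. The plane is not moved, so the two sets of crossings are equal and not merely
  equinumerous.\<close>

lemma passes_over_same_picture: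
  assumes D: "link_diagram D" "link_diagram D'"
    and len: "length (fst D') = length (fst D)"
    and \<pi>: "bij_betw \<pi> {..<length (fst D)} {..<length (fst D)}"
    and h: "\<And>i. i < length (fst D) \<Longrightarrow> circle_reparam (h i)"
    and curve: "\<And>i. i < length (fst D) \<Longrightarrow> fst D' ! i = (fst D ! \<pi> i) \<circ> h i"
    and res: "\<And>p. snd D p = map_option (\<lambda>(i, t). (\<pi> i, frac (h i t))) (snd D' p)"
    and ij: "i < length (fst D)" "j < length (fst D)"
  shows "passes_over D (\<pi> i) (\<pi> j) = passes_over D' i j"
proof -
  let ?n = "length (fst D)"
  have \<pi>_lt: "\<pi> k < ?n" if "k < ?n" for k
    using \<pi> that by (auto simp: bij_betw_def)
  have \<pi>_inj: "k = l" if "\<pi> k = \<pi> l" "k < ?n" "l < ?n" for k l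
    using \<pi> that by (auto simp: bij_betw_def inj_on_def)
  have per: "(fst D ! k) (frac t) = (fst D ! k) t" if "k < ?n" for k t
    using D that by (intro periodic_frac link_shadow_periodic) (auto simp: link_diagram_def)
  have per': "(fst D' ! k) (frac t) = (fst D' ! k) t" if "k < ?n" for k t
    using D that len by (intro periodic_frac link_shadow_periodic) (auto simp: link_diagram_def)
  show ?thesis
  proof (intro set_eqI iffI)
    fix p assume "p \<in> passes_over D (\<pi> i) (\<pi> j)"
    then obtain x t where x: "snd D p = Some x" "fst x = \<pi> i" and t: "(\<pi> j, t) \<in> strands (fst D) p"
      by (auto simp: passes_over_def)
    obtain x' where x': "snd D' p = Some x'" "x = (\<pi> (fst x'), frac (h (fst x') (snd x')))"
      using x res[of p] by (cases "snd D' p") (auto simp: case_prod_beta)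
    have "x' \<in> strands (fst D') p" using D(2) x'(1) unfolding link_diagram_def by blast
    then have "fst x' < ?n" by (auto simp: strands_def lpoints_def len)
    then have "fst x' = i" using \<pi>_inj x x' ij by auto
    \<comment> \<open>The resolution records the upper strand only; the lower one is traced back to
      a parameter of \<open>D'\<close> by surjectivity.\<close>
    obtain s where s: "h j s = t" using circle_reparam_surj[OF h[OF ij(2)]] by (metis surjD)
    have "(fst D' ! j) (frac s) = p"
      using per'[OF ij(2)] curve[OF ij(2)] s t by (simp add: strands_def proj_def)
    then have "(j, frac s) \<in> strands (fst D') p"
      using ij len by (auto simp: strands_def proj_def lpoints_def frac_lt_1)
    then show "p \<in> passes_over D' i j"
      using x'(1) \<open>fst x' = i\<close> unfolding passes_over_def by force
  next
    fix p assume "p \<in> passes_over D' i j"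
    then obtain x t where x: "snd D' p = Some x" "fst x = i" and t: "(j, t) \<in> strands (fst D') p"
      by (auto simp: passes_over_def)
    have "(\<pi> j, frac (h j t)) \<in> strands (fst D) p"
      using t ij per[OF \<pi>_lt[OF ij(2)]] \<pi>_lt[OF ij(2)] curve[OF ij(2)]
      by (auto simp: strands_def proj_def lpoints_def frac_lt_1)
    moreover have "snd D p = Some (\<pi> i, frac (h i (snd x)))"
      using x res[of p] by (simp add: case_prod_beta)
    ultimately show "p \<in> passes_over D (\<pi> i) (\<pi> j)"
      by (fastforce simp: passes_over_def)
  qed
qed

lemma passes_over_out_of_range:
  assumes "link_diagram D" "\<not> (i < length (fst D) \<and> j < length (fst D))"
  shows "passes_over D i j = {}"
  using assms by (fastforce simp: passes_over_def link_diagram_def strands_def lpoints_def)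

text \<open>Indices beyond the list contribute the empty set, so only those permuted by a
  renumbering matter.\<close>

lemma evenly_linked_alt:
  assumes "link_diagram D"
  shows "evenly_linked D \<longleftrightarrow>
    (\<forall>i<length (fst D). \<forall>j<length (fst D). i \<noteq> j \<longrightarrow> even (card (passes_over D i j)))"
  unfolding evenly_linked_def
  by (metis passes_over_out_of_range[OF assms] card.empty even_zero)

lemma evenly_linked_same_picture:
  assumes D: "link_diagram D" "link_diagram D'" and "same_picture D D'"
  shows "evenly_linked D \<longleftrightarrow> evenly_linked D'"
proof -
  obtain \<pi> h where len: "length (fst D') = length (fst D)"
    and \<pi>: "bij_betw \<pi> {..<length (fst D)} {..<length (fst D)}"
    and *: "\<And>i. i < length (fst D) \<Longrightarrow> circle_reparam (h i)"
      "\<And>i. i < length (fst D) \<Longrightarrow> fst D' ! i = (fst D ! \<pi> i) \<circ> h i"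
      "\<And>p. snd D p = map_option (\<lambda>(i, t). (\<pi> i, frac (h i t))) (snd D' p)"
    using assms(3) unfolding same_picture_def by blast
  let ?N = "{..<length (fst D)}"
  note eq = passes_over_same_picture[OF D len \<pi> *]
  have inj: "inj_on \<pi> ?N" and im: "\<pi> ` ?N = ?N" using \<pi> by (auto simp: bij_betw_def)
  have "evenly_linked D \<longleftrightarrow> (\<forall>i\<in>?N. \<forall>j\<in>?N. i \<noteq> j \<longrightarrow> even (card (passes_over D i j)))"
    unfolding evenly_linked_alt[OF D(1)] by auto
  also have "\<dots> \<longleftrightarrow> (\<forall>i\<in>\<pi> ` ?N. \<forall>j\<in>\<pi> ` ?N. i \<noteq> j \<longrightarrow> even (card (passes_over D i j)))"
    by (simp only: im)
  also have "\<dots> \<longleftrightarrow> (\<forall>i\<in>?N. \<forall>j\<in>?N. i \<noteq> j \<longrightarrow> even (card (passes_over D (\<pi> i) (\<pi> j))))"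
    using inj by (auto simp: inj_on_eq_iff)
  also have "\<dots> \<longleftrightarrow> evenly_linked D'"
    unfolding evenly_linked_alt[OF D(2)] len by (auto simp: eq)
  finally show ?thesis .
qed

text \<open>Strands are recorded by component and parameter, which composition leaves alone;
  injectivity excludes new coincidences.\<close>

lemma strands_map_comp:
  assumes "inj F"
  shows "strands (map (\<lambda>g. F \<circ> g) S) (F p) = strands S p"
  using assms by (auto simp: strands_def lpoints_def proj_def inj_eq)

lemma evenly_linked_planar_isotopic:
  assumes "planar_isotopic D D'"
  shows "evenly_linked D \<longleftrightarrow> evenly_linked D'"
proof -
  obtain H where H: "ambient_isotopy H" "fst D' = map (\<lambda>g. H 1 \<circ> g) (fst D)"
    "\<And>p. snd D' (H 1 p) = snd D p"
    using assms unfolding planar_isotopic_def by blast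
  have bij: "bij (H 1)" using H(1) by (auto simp: ambient_isotopy_def)
  have "passes_over D' i j = H 1 ` passes_over D i j" for i j
  proof (intro set_eqI iffI)
    fix q assume q: "q \<in> passes_over D' i j"
    obtain p where "q = H 1 p" using bij by (metis bij_is_surj surjD)
    then show "q \<in> H 1 ` passes_over D i j"
      using q H strands_map_comp[OF bij_is_inj[OF bij]] by (auto simp: passes_over_def)
  next
    fix q assume "q \<in> H 1 ` passes_over D i j"
    then show "q \<in> passes_over D' i j"
      using H strands_map_comp[OF bij_is_inj[OF bij]] by (auto simp: passes_over_def)
  qed
  then have "card (passes_over D' i j) = card (passes_over D i j)" for i j
    using bij by (simp add: card_image bij_is_inj inj_on_subset[of _ UNIV])
  then show ?thesis by (simp add: evenly_linked_def)
qed

section \<open>Counting crossings in the disc of a move\<close>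

lemma arc_points_fst: "x \<in> arc_points A \<Longrightarrow> fst x = fst A"
  by (cases A) auto

lemma tangle_strands:
  assumes "tangle S c r As" "A \<in> set As" "x \<in> arc_points A"
  shows "x \<in> strands S (proj S x)" "proj S x \<in> cball c r"
  using assms unfolding tangle_def strands_def by auto

text \<open>
  The restriction to \<open>k < l\<close> is no loss for layered arcs: it makes the arc \<open>As ! k\<close> the upper one.
\<close>

lemma card_passes_over_tangle:
  assumes D: "link_diagram D" and T: "tangle (fst D) c r As"
    and lay: "\<And>k l. k < l \<Longrightarrow> l < length As \<Longrightarrow> lies_over D (As ! k) (As ! l)"
    and ij: "i \<noteq> j"
  shows "card (passes_over D i j \<inter> cball c r) =
    (\<Sum>(k, l) \<in> {(k, l). k < l \<and> l < length As \<and> fst (As ! k) = i \<and> fst (As ! l) = j}.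
       card (meets (fst D) (As ! k) (As ! l)))"
proof -
  let ?S = "fst D"
  let ?I = "{(k, l). k < l \<and> l < length As \<and> fst (As ! k) = i \<and> fst (As ! l) = j}"
  have S: "link_shadow ?S" and over: "\<And>p x. snd D p = Some x \<Longrightarrow> x \<in> strands ?S p"
    and dom: "dom (snd D) = crossings ?S"
    using D by (auto simp: link_diagram_def)
  have disj: "k = l" if "x \<in> arc_points (As ! k)" "x \<in> arc_points (As ! l)"
      "k < length As" "l < length As" for x k l
  proof -
    have "disjoint_family_on (\<lambda>k. arc_points (As ! k)) {..<length As}"
      using T by (simp add: tangle_def)
    from disjoint_family_onD[OF this, of k l] that show ?thesis by auto
  qed
  have arc: "x \<in> strands ?S (proj ?S x)" "proj ?S x \<in> cball c r"
    if "x \<in> arc_points (As ! k)" "k < length As" for x k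
    using tangle_strands[OF T nth_mem] that by auto
  have ex_arc: "\<exists>k<length As. x \<in> arc_points (As ! k)" if "x \<in> strands ?S p" "p \<in> cball c r" for x p
  proof -
    have "x \<in> (\<Union>A\<in>set As. arc_points A)"
      using T that unfolding tangle_def strands_def by blast
    then show ?thesis by (metis UN_E in_set_conv_nth)
  qed
  have fin: "finite ?I" by (rule finite_subset[of _ "{..<length As} \<times> {..<length As}"]) auto
  have meets_strands: "\<exists>x y. x \<in> arc_points (As ! k) \<and> y \<in> arc_points (As ! l) \<and>
      x \<in> strands ?S p \<and> y \<in> strands ?S p \<and> p \<in> cball c r"
    if p: "p \<in> meets ?S (As ! k) (As ! l)" and kl: "k < length As" "l < length As" for p k l
  proof -
    obtain x y where xy: "x \<in> arc_points (As ! k)" "y \<in> arc_points (As ! l)"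
      "proj ?S x = p" "proj ?S y = p"
      using p unfolding meets_def by blast
    then show ?thesis
      using arc[OF xy(1) kl(1)] arc[OF xy(2) kl(2)] by metis
  qed
  have eq: "passes_over D i j \<inter> cball c r = (\<Union>(k, l)\<in>?I. meets ?S (As ! k) (As ! l))"
  proof (intro set_eqI iffI)
    fix p assume p: "p \<in> passes_over D i j \<inter> cball c r"
    then obtain x y where x: "snd D p = Some x" "fst x = i" and y: "y \<in> strands ?S p" "fst y = j"
      by (auto simp: passes_over_def)
    have xs: "x \<in> strands ?S p" using over x by auto
    obtain k l where k: "k < length As" "x \<in> arc_points (As ! k)"
      and l: "l < length As" "y \<in> arc_points (As ! l)"
      using ex_arc[OF xs] ex_arc[OF y(1)] p by auto
    have px: "proj ?S x = p" "proj ?S y = p" using xs y by (auto simp: strands_def)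
    have "x \<noteq> y" using x y ij by auto
    then have m: "p \<in> meets ?S (As ! k) (As ! l)" "p \<in> meets ?S (As ! l) (As ! k)"
      unfolding meets_def mem_Collect_eq using k l px by metis+
    \<comment> \<open>If the arc of \<open>y\<close> came first, the layering would put the upper
      strand on \<open>As ! l\<close>. But the upper strand is \<open>x\<close>, on
      \<open>As ! k\<close>, which is disjoint from it.\<close>
    have "\<not> l < k"
    proof
      assume "l < k"
      then obtain x' where "x' \<in> arc_points (As ! l)" "snd D p = Some x'"
        using lay[of l k] k m by (auto simp: lies_over_def)
      then have "x \<in> arc_points (As ! l)" using x(1) by simp
      then have "k = l" using disj[OF k(2)] k(1) l(1) by blast
      then show False using \<open>l < k\<close> by simp
    qed
    moreover have "k \<noteq> l" using x y k l ij by (auto dest!: arc_points_fst)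
    ultimately have "(k, l) \<in> ?I" using x y k l by (auto dest!: arc_points_fst)
    then show "p \<in> (\<Union>(k, l)\<in>?I. meets ?S (As ! k) (As ! l))" using m by blast
  next
    fix p assume "p \<in> (\<Union>(k, l)\<in>?I. meets ?S (As ! k) (As ! l))"
    then obtain k l where kl: "k < l" "l < length As" "fst (As ! k) = i" "fst (As ! l) = j"
      and m: "p \<in> meets ?S (As ! k) (As ! l)" by auto
    obtain y where y: "y \<in> arc_points (As ! l)" "y \<in> strands ?S p" "p \<in> cball c r"
      using meets_strands[OF m] kl by auto
    obtain x where x: "x \<in> arc_points (As ! k)" "snd D p = Some x"
      using lay[of k l] kl m by (auto simp: lies_over_def)
    then have "p \<in> passes_over D i j"
      using y kl arc_points_fst[OF x(1)] arc_points_fst[OF y(1)]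
      unfolding passes_over_def by blast
    then show "p \<in> passes_over D i j \<inter> cball c r" using y(3) by blast
  qed
  have fin_meets: "finite (meets ?S (As ! k) (As ! l))" if "(k, l) \<in> ?I" for k l
    using eq finite_passes_over[OF D] that by (metis (mono_tags, lifting) UN_upper case_prod_conv finite_Int finite_subset)
  have "card (\<Union>u\<in>?I. case u of (k, l) \<Rightarrow> meets ?S (As ! k) (As ! l)) =
      (\<Sum>u\<in>?I. card (case u of (k, l) \<Rightarrow> meets ?S (As ! k) (As ! l)))"
  proof (rule card_UN_disjoint[OF fin])
    show "\<forall>u\<in>?I. finite (case u of (k, l) \<Rightarrow> meets ?S (As ! k) (As ! l))"
      using fin_meets by auto
    show "\<forall>u\<in>?I. \<forall>v\<in>?I. u \<noteq> v \<longrightarrow> (case u of (k, l) \<Rightarrow> meets ?S (As ! k) (As ! l)) \<inter>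
        (case v of (k, l) \<Rightarrow> meets ?S (As ! k) (As ! l)) = {}"
    proof (intro ballI impI)
      fix u v assume u: "u \<in> ?I" and v: "v \<in> ?I" and "u \<noteq> v"
      obtain k l where kl: "u = (k, l)" by (cases u)
      obtain k' l' where kl': "v = (k', l')" by (cases v)
      have False if p: "p \<in> meets ?S (As ! k) (As ! l)" "p \<in> meets ?S (As ! k') (As ! l')" for p
      proof -
        obtain x y where xy: "x \<in> arc_points (As ! k)" "y \<in> arc_points (As ! l)"
          "x \<in> strands ?S p" "y \<in> strands ?S p"
          using meets_strands[OF p(1)] u kl by auto
        obtain x' y' where xy': "x' \<in> arc_points (As ! k')" "y' \<in> arc_points (As ! l')"
          "x' \<in> strands ?S p" "y' \<in> strands ?S p"
          using meets_strands[OF p(2)] v kl' by auto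
        have f: "fst x = i" "fst x' = i" "fst y = j" "fst y' = j"
          using xy xy' u v kl kl' by (auto dest!: arc_points_fst)
        \<comment> \<open>At most two strands pass through \<open>p\<close>, one of component
          \<open>i\<close> and one of component \<open>j\<close>, so the two pairs of strands
          coincide and with them the arcs.\<close>
        then have "x \<noteq> y" "x' \<noteq> y" "y' \<noteq> x" using ij by auto
        then have "x' = x" "y' = y"
          using strands_at_most_two[OF S xy(3,4) xy'(3)] strands_at_most_two[OF S xy(3,4) xy'(4)]
          by blast+
        then have "k' = k" "l' = l"
          using disj[of x k' k] disj[of y l' l] xy(1,2) xy'(1,2) u v kl kl' by simp_all
        then show False using \<open>u \<noteq> v\<close> kl kl' by simp
      qed
      then show "(case u of (k, l) \<Rightarrow> meets ?S (As ! k) (As ! l)) \<inter>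
          (case v of (k, l) \<Rightarrow> meets ?S (As ! k) (As ! l)) = {}"
        using kl kl' by auto
    qed
  qed
  then show ?thesis by (simp add: eq case_prod_beta)
qed

text \<open>In both diagrams the arcs make up exactly the part in the disc. So the strands at a
  point outside the disc avoid the arcs, where the two projections agree.\<close>

lemma passes_over_local_change:
  assumes "local_change c r As D D'"
  shows "passes_over D i j - cball c r = passes_over D' i j - cball c r"
proof -
  let ?A = "\<Union>A\<in>set As. arc_points A"
  have T: "tangle (fst D) c r As" "tangle (fst D') c r As"
    and len: "length (fst D) = length (fst D')"
    and eq: "\<And>x. x \<in> lpoints (fst D) - ?A \<Longrightarrow> proj (fst D) x = proj (fst D') x"
    and res: "\<And>p. p \<notin> cball c r \<Longrightarrow> snd D p = snd D' p"
    using assms unfolding local_change_def by blast+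
  have lp: "lpoints (fst D) = lpoints (fst D')" by (simp add: lpoints_def len)
  have in_arcs: "{x \<in> lpoints (fst D). proj (fst D) x \<in> cball c r} = ?A"
      "{x \<in> lpoints (fst D'). proj (fst D') x \<in> cball c r} = ?A"
    using T unfolding tangle_def by blast+
  have "strands (fst D) p = strands (fst D') p" if "p \<notin> cball c r" for p
    using in_arcs eq that lp unfolding strands_def by (smt (verit) Collect_cong Diff_iff mem_Collect_eq)
  then show ?thesis using res by (auto simp: passes_over_def)
qed

text \<open>Outside the disc the counts agree, and inside they are sums over pairs of arcs. Lists of
  layered arcs of any length cover all three moves at once.\<close>

lemma evenly_linked_local_change:
  assumes D: "link_diagram D" "link_diagram D'" and lc: "local_change c r As D D'"
    and lay: "\<And>k l. k < l \<Longrightarrow> l < length As \<Longrightarrow> lies_over D (As ! k) (As ! l)"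
      "\<And>k l. k < l \<Longrightarrow> l < length As \<Longrightarrow> lies_over D' (As ! k) (As ! l)"
    and par: "\<And>k l. k < l \<Longrightarrow> l < length As \<Longrightarrow>
      even (card (meets (fst D) (As ! k) (As ! l))) = even (card (meets (fst D') (As ! k) (As ! l)))"
  shows "evenly_linked D \<longleftrightarrow> evenly_linked D'"
proof -
  have T: "tangle (fst D) c r As" "tangle (fst D') c r As"
    using lc unfolding local_change_def by blast+
  have split: "card (passes_over E i j) =
      card (passes_over E i j - cball c r) + card (passes_over E i j \<inter> cball c r)"
    if "link_diagram E" for E i j
    using card_Int_Diff[OF finite_passes_over[OF that]] by (metis add.commute)
  have "even (card (passes_over D i j)) = even (card (passes_over D' i j))" if "i \<noteq> j" for i j
  proof -
    let ?I = "{(k, l). k < l \<and> l < length As \<and> fst (As ! k) = i \<and> fst (As ! l) = j}"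
    have fin: "finite ?I" by (rule finite_subset[of _ "{..<length As} \<times> {..<length As}"]) auto
    \<comment> \<open>A sum is even iff the number of its odd terms is, so it suffices that the same
      pairs contribute odd terms.\<close>
    have "{u\<in>?I. odd (case u of (k, l) \<Rightarrow> card (meets (fst D) (As ! k) (As ! l)))} =
        {u\<in>?I. odd (case u of (k, l) \<Rightarrow> card (meets (fst D') (As ! k) (As ! l)))}"
      using par by auto
    then have "even (card (passes_over D i j \<inter> cball c r)) = even (card (passes_over D' i j \<inter> cball c r))"
      by (simp add: card_passes_over_tangle[OF D(1) T(1) lay(1) that]
          card_passes_over_tangle[OF D(2) T(2) lay(2) that] even_sum_iff[OF fin])
    then show ?thesis
      using split D passes_over_local_change[OF lc, of i j] by simp
  qed
  then show ?thesis by (auto simp: evenly_linked_def)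
qed

section \<open>Invariance under equivalence and the obstruction to splitting\<close>

lemma evenly_linked_elementary_step:
  assumes "elementary_step D D'"
  shows "evenly_linked D \<longleftrightarrow> evenly_linked D'"
proof -
  have D: "link_diagram D" "link_diagram D'" using assms by (auto simp: elementary_step_def)
  consider "same_picture D D'" | "planar_isotopic D D'" | "reidemeister1 D D'"
    | "reidemeister2 D D'" | "reidemeister3 D D'"
    using assms by (auto simp: elementary_step_def)
  then show ?thesis
  proof cases
    case 1
    then show ?thesis using evenly_linked_same_picture D by blast
  next
    case 2
    then show ?thesis by (rule evenly_linked_planar_isotopic)
  next
    case 3
    then obtain c r A where "local_change c r [A] D D'" unfolding reidemeister1_def by blast
    \<comment> \<open>A single arc has no pair \<open>k < l\<close>, so all conditions are
      vacuous.\<close>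
    then show ?thesis by (rule evenly_linked_local_change[OF D]) auto
  next
    case 4
    then obtain c r A B where lc: "local_change c r [A, B] D D'" and
      m: "meets (fst D) A B = {}" "card (meets (fst D') A B) = 2" "lies_over D' A B"
      unfolding reidemeister2_def by blast
    \<comment> \<open>The number of meeting points goes from 0 to 2; before the move
      \<open>lies_over\<close> is vacuous.\<close>
    show ?thesis
      using m by (intro evenly_linked_local_change[OF D lc])
        (auto simp: less_Suc_eq lies_over_def)
  next
    case 5
    then obtain c r A B C where lc: "local_change c r [A, B, C] D D'" and
      m: "layered_triangle D A B C" "layered_triangle D' A B C"
      unfolding reidemeister3_def by blast
    \<comment> \<open>Every pair of arcs meets exactly once before and after the move.\<close>
    show ?thesis
      using m by (intro evenly_linked_local_change[OF D lc])
        (auto simp: less_Suc_eq numeral_2_eq_2 layered_triangle_def)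
  qed
qed

lemma diagram_equiv_invariants:
  assumes "diagram_equiv D D'" "link_diagram D"
  shows "link_diagram D' \<and> length (fst D) = length (fst D') \<and> (evenly_linked D \<longleftrightarrow> evenly_linked D')"
proof -
  have len: "length (fst D) = length (fst D')" if "elementary_step D D'" for D D'
    using that unfolding elementary_step_def same_picture_def planar_isotopic_def
      reidemeister1_def reidemeister2_def reidemeister3_def local_change_def by auto
  show ?thesis
    using assms(1) unfolding diagram_equiv_def
  proof (induction rule: equivclp_induct)
    case (step y z)
    \<comment> \<open>The step may run in either direction, so each fact is used for
      \<open>(y, z)\<close> and for \<open>(z, y)\<close>.\<close>
    then have "link_diagram z" "evenly_linked y \<longleftrightarrow> evenly_linked z" "length (fst y) = length (fst z)"
      using evenly_linked_elementary_step[of y z] evenly_linked_elementary_step[of z y]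
        len[of y z] len[of z y] elementary_step_def[of y z] elementary_step_def[of z y]
      by metis+
    then show ?case using step.IH by simp
  qed (simp add: assms)
qed

text \<open>In the split diagram the two components lie on different sides of the circle and share
  no point, so all counts are 0 there; their parities are invariant.\<close>

lemma splittable_imp_evenly_linked:
  assumes "splittable D" "link_diagram D" "length (fst D) = 2"
  shows "evenly_linked D"
proof -
  obtain D' where eq: "diagram_equiv D D'" and split: "split_by_circle (fst D')"
    using assms(1) by (auto simp: splittable_def)
  have D': "link_diagram D'" "evenly_linked D \<longleftrightarrow> evenly_linked D'" "length (fst D') = 2"
    using diagram_equiv_invariants[OF eq] assms(2,3) by auto
  obtain c r I where I: "I \<noteq> {}" "I \<subset> {..<2}"
    and inside: "\<forall>i\<in>I. range (fst D' ! i) \<subseteq> ball c r"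
    and outside: "\<forall>i\<in>{..<2} - I. range (fst D' ! i) \<subseteq> - cball c r"
    using split unfolding split_by_circle_def D'(3) by blast
  have "I = {0} \<or> I = {1}" using I by (auto simp: lessThan_Suc numeral_2_eq_2)
  then have I_iff: "i \<in> I \<longleftrightarrow> j \<notin> I" if "i \<noteq> j" "i < 2" "j < 2" for i j
    using that by (auto simp: less_Suc_eq numeral_2_eq_2)
  have "passes_over D' i j = {}" if "i \<noteq> j" for i j
  proof (rule ccontr)
    assume "passes_over D' i j \<noteq> {}"
    then obtain p x y where x: "snd D' p = Some x" "fst x = i" and y: "y \<in> strands (fst D') p" "fst y = j"
      by (auto simp: passes_over_def)
    have "x \<in> strands (fst D') p" using x(1) D'(1) unfolding link_diagram_def by blast
    then have p: "(fst D' ! i) (snd x) = p" "(fst D' ! j) (snd y) = p" and lt: "i < 2" "j < 2"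
      using x y D'(3) by (auto simp: strands_def proj_def lpoints_def)
    have "p \<in> range (fst D' ! i)" "p \<in> range (fst D' ! j)"
      using rangeI[of "fst D' ! i" "snd x"] rangeI[of "fst D' ! j" "snd y"] by (simp_all add: p)
    then have on: "i \<in> I \<Longrightarrow> p \<in> ball c r" "j \<in> I \<Longrightarrow> p \<in> ball c r"
      "i \<notin> I \<Longrightarrow> p \<notin> cball c r" "j \<notin> I \<Longrightarrow> p \<notin> cball c r"
      using inside outside lt by blast+
    then show False
      using I_iff[OF that lt] ball_subset_cball[of c r] by blast
  qed
  then show ?thesis using D'(2) by (simp add: evenly_linked_def)
qed

section \<open>Strategy of the Linker\<close>

lemma crossings_eq: "crossings S = self_intersections S \<union> non_self_intersections S"
  unfolding crossings_def self_intersections_def non_self_intersections_def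
    Collect_disj_eq[symmetric]
  by (rule Collect_cong) metis

text \<open>The pair of strands that witnesses a self-intersection comprises all strands at the
  point.\<close>

lemma self_intersections_disjoint:
  assumes "link_shadow S"
  shows "self_intersections S \<inter> non_self_intersections S = {}"
proof (rule ccontr)
  assume "\<not> ?thesis"
  then obtain p x y x' y' where xy: "x \<in> strands S p" "y \<in> strands S p" "x \<noteq> y" "fst x = fst y"
    and xy': "x' \<in> strands S p" "y' \<in> strands S p" "fst x' \<noteq> fst y'"
    unfolding self_intersections_def non_self_intersections_def by blast
  then show False
    using strands_at_most_two[OF assms xy(1,2) xy'(1) xy(3)]
      strands_at_most_two[OF assms xy(1,2) xy'(2) xy(3)] by auto
qed

lemma finite_intersections:
  assumes "link_shadow S"
  shows "finite (self_intersections S)" "finite (non_self_intersections S)"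
  using assms unfolding link_shadow_def crossings_eq by auto

section \<open>Linking parity of a completed play\<close>

lemma final_diagram_link_diagram:
  assumes "link_shadow S" "complete_play S ms"
  shows "link_diagram (final_diagram S ms)"
  using assms
  by (auto simp: link_diagram_def final_diagram_def complete_play_def legal_play_def dom_map_of_conv_image_fst
      dest!: map_of_SomeD)

text \<open>This lets the Linker put whichever component is wanted on top.\<close>

lemma non_self_intersection_strand:
  assumes "length S = 2" "p \<in> non_self_intersections S" "i < 2"
  shows "\<exists>x\<in>strands S p. fst x = i"
proof -
  obtain x y where "x \<in> strands S p" "y \<in> strands S p" "fst x \<noteq> fst y"
    using assms(2) by (auto simp: non_self_intersections_def)
  moreover from this have "fst x < 2" "fst y < 2"
    using assms(1) by (auto simp: strands_def lpoints_def)
  ultimately have "fst x = i \<or> fst y = i" using assms(3) by linarith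
  with \<open>x \<in> strands S p\<close> \<open>y \<in> strands S p\<close> show ?thesis by blast
qed

text \<open>Defined for partial plays too: this is the count whose parity the Linker steers during
  the game.\<close>

definition first_over :: "shadow \<Rightarrow> move list \<Rightarrow> complex set" where
  "first_over S ms = {p \<in> non_self_intersections S. \<exists>t. (p, 0, t) \<in> set ms}"

lemma passes_over_final_diagram:
  assumes S: "link_shadow S" "length S = 2" and ms: "complete_play S ms"
  shows "passes_over (final_diagram S ms) 0 1 = first_over S ms"
    and "passes_over (final_diagram S ms) 1 0 = non_self_intersections S - first_over S ms"
proof -
  have dist: "distinct (map fst ms)" and legal: "\<And>p x. (p, x) \<in> set ms \<Longrightarrow> x \<in> strands S p"
    and compl: "fst ` set ms = crossings S"
    using ms by (auto simp: complete_play_def legal_play_def)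
  have map: "map_of ms p = Some x \<longleftrightarrow> (p, x) \<in> set ms" for p x
    using dist by (simp add: map_of_eq_Some_iff)
  have lt: "fst x < 2" if "x \<in> strands S p" for x p
    using that S(2) by (auto simp: strands_def lpoints_def)
  have over: "passes_over (final_diagram S ms) i (1 - i) =
      {p \<in> non_self_intersections S. \<exists>t. (p, i, t) \<in> set ms}" if "i \<in> {0, 1}" for i
  proof (intro set_eqI iffI)
    fix p assume "p \<in> passes_over (final_diagram S ms) i (1 - i)"
    then obtain x y where x: "(p, x) \<in> set ms" "fst x = i" and y: "y \<in> strands S p" "fst y = 1 - i"
      by (auto simp: passes_over_def final_diagram_def map)
    have "fst x \<noteq> fst y" using x y that by auto
    then have "p \<in> non_self_intersections S"
      unfolding non_self_intersections_def using legal[OF x(1)] y by blast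
    then show "p \<in> {p \<in> non_self_intersections S. \<exists>t. (p, i, t) \<in> set ms}"
      using x by (metis (mono_tags, lifting) mem_Collect_eq prod.collapse)
  next
    fix p assume "p \<in> {p \<in> non_self_intersections S. \<exists>t. (p, i, t) \<in> set ms}"
    then show "p \<in> passes_over (final_diagram S ms) i (1 - i)"
      using non_self_intersection_strand[OF S(2), of p "1 - i"] that
      by (fastforce simp: passes_over_def final_diagram_def map)
  qed
  show "passes_over (final_diagram S ms) 0 1 = first_over S ms"
    using over[of 0] by (simp add: first_over_def)
  \<comment> \<open>A complete play resolves \<open>p\<close> in exactly one move, which puts one of
    the two components on top.\<close>
  have "(\<exists>t. (p, 1, t) \<in> set ms) \<longleftrightarrow> \<not> (\<exists>t. (p, 0, t) \<in> set ms)"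
    if "p \<in> non_self_intersections S" for p
  proof -
    have "p \<in> fst ` set ms" using that compl by (simp add: crossings_eq)
    then obtain x where x: "(p, x) \<in> set ms" by force
    have iff: "(p, y) \<in> set ms \<longleftrightarrow> y = x" for y
      using x map[of p x] map[of p y] by auto
    have "fst x < 2" by (rule lt[OF legal[OF x]])
    then show ?thesis unfolding iff by (cases x) (auto simp: less_2_cases_iff)
  qed
  then show "passes_over (final_diagram S ms) 1 0 = non_self_intersections S - first_over S ms"
    using over[of 1] by (auto simp: first_over_def)
qed

text \<open>The counts for the two orders add up to the number of non-self-intersections, so one of
  them is odd if that number is.\<close>

lemma unsplittable_final_diagram:
  assumes S: "link_shadow S" "length S = 2" and ms: "complete_play S ms"
    and odd: "odd (card (first_over S ms)) \<or> odd (card (non_self_intersections S))"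
  shows "\<not> splittable (final_diagram S ms)"
proof
  assume "splittable (final_diagram S ms)"
  then have "evenly_linked (final_diagram S ms)"
    using splittable_imp_evenly_linked final_diagram_link_diagram[OF S(1) ms] S(2)
    by (simp add: final_diagram_def)
  then have "even (card (first_over S ms))" "even (card (non_self_intersections S - first_over S ms))"
    using passes_over_final_diagram[OF S ms] unfolding evenly_linked_def
    by (metis zero_neq_one)+
  moreover have "first_over S ms \<subseteq> non_self_intersections S" by (auto simp: first_over_def)
  then have "card (non_self_intersections S) =
      card (first_over S ms) + card (non_self_intersections S - first_over S ms)"
    using finite_intersections(2)[OF S(1)] card_Int_Diff[of _ "first_over S ms"]
    by (metis Int_absorb1)
  ultimately show False using odd by auto
qed

section \<open>Safe and threatened positions\<close>

definition unresolved :: "complex set \<Rightarrow> move list \<Rightarrow> complex set" where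
  "unresolved A ms = A - fst ` set ms"

text \<open>
  The Linker moves so as to hand over safe positions only.  The positions that then come back
  are the threatened ones.
\<close>

definition safe_position :: "shadow \<Rightarrow> move list \<Rightarrow> bool" where
  "safe_position S ms \<longleftrightarrow>
     even (card (unresolved (self_intersections S) ms)) \<and>
     even (card (unresolved (non_self_intersections S) ms)) \<and>
     (unresolved (non_self_intersections S) ms = {} \<longrightarrow> odd (card (first_over S ms)))"

text \<open>An odd sum says that exactly one of the two counts is odd; the Linker's answer is a
  crossing of that kind.\<close>

definition threatened_position :: "shadow \<Rightarrow> move list \<Rightarrow> bool" where
  "threatened_position S ms \<longleftrightarrow>
     odd (card (unresolved (self_intersections S) ms) + card (unresolved (non_self_intersections S) ms)) \<and>
     (unresolved (non_self_intersections S) ms = {} \<longrightarrow> odd (card (first_over S ms)))"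

lemma legal_play_snoc:
  "legal_play S (ms @ [(p, x)]) \<longleftrightarrow>
     legal_play S ms \<and> p \<in> unresolved (crossings S) ms \<and> x \<in> strands S p"
  by (auto simp: legal_play_def unresolved_def)

lemma card_unresolved_snoc:
  assumes "finite A"
  shows "p \<in> unresolved A ms \<Longrightarrow> card (unresolved A ms) = Suc (card (unresolved A (ms @ [(p, x)])))"
    and "p \<notin> unresolved A ms \<Longrightarrow> unresolved A (ms @ [(p, x)]) = unresolved A ms"
proof -
  have eq: "unresolved A (ms @ [(p, x)]) = unresolved A ms - {p}"
    by (auto simp: unresolved_def)
  have "finite (unresolved A ms)" using assms by (simp add: unresolved_def)
  then show "p \<in> unresolved A ms \<Longrightarrow> card (unresolved A ms) = Suc (card (unresolved A (ms @ [(p, x)])))"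
    unfolding eq by (rule card_Suc_Diff1[symmetric])
  show "p \<notin> unresolved A ms \<Longrightarrow> unresolved A (ms @ [(p, x)]) = unresolved A ms"
    unfolding eq by simp
qed

lemma first_over_snoc:
  "first_over S (ms @ [(p, x)]) =
     first_over S ms \<union> (if p \<in> non_self_intersections S \<and> fst x = 0 then {p} else {})"
  by (cases x) (auto simp: first_over_def)

text \<open>A move lowers exactly one of two even counts. If it is that of the
  non-self-intersections, an odd number of them remains and the clause for none left is vacuous;
  otherwise \<open>first_over\<close> is unchanged.\<close>

lemma threatened_after_safe:
  assumes S: "link_shadow S" and safe: "safe_position S ms" and legal: "legal_play S (ms @ [m])"
  shows "threatened_position S (ms @ [m])"
proof -
  obtain p x where m: "m = (p, x)" by (cases m)
  let ?A = "self_intersections S" and ?B = "non_self_intersections S"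
  note fin = finite_intersections[OF S]
  have p: "p \<in> unresolved ?A ms \<or> p \<in> unresolved ?B ms"
    using legal unfolding m legal_play_snoc crossings_eq unresolved_def by auto
  show ?thesis
  proof (cases "p \<in> unresolved ?A ms")
    case True
    then have "p \<notin> ?B" using self_intersections_disjoint[OF S] by (auto simp: unresolved_def)
    then have "unresolved ?B (ms @ [m]) = unresolved ?B ms" "first_over S (ms @ [m]) = first_over S ms"
      unfolding m by (auto simp: first_over_snoc unresolved_def)
    then show ?thesis
      using safe card_unresolved_snoc(1)[OF fin(1) True, of x]
      by (simp add: safe_position_def threatened_position_def m)
  next
    case False
    with p have pB: "p \<in> unresolved ?B ms" by simp
    have "odd (card (unresolved ?B (ms @ [m])))"
      using safe card_unresolved_snoc(1)[OF fin(2) pB, of x] by (simp add: safe_position_def m)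
    then show ?thesis
      using safe card_unresolved_snoc(2)[OF fin(1) False, of x]
      by (auto simp: safe_position_def threatened_position_def m)
  qed
qed

lemma crossing_strand:
  assumes "p \<in> crossings S"
  shows "\<exists>x. x \<in> strands S p"
  using assms by (auto simp: crossings_def)

text \<open>Resolving a crossing of the kind whose count is odd makes both counts even. Emptiness is
  no obstacle, since an odd count is not 0.\<close>

lemma safe_after_threatened:
  assumes S: "link_shadow S" "length S = 2"
    and thr: "threatened_position S ms" and legal: "legal_play S ms"
  shows "\<exists>m. legal_play S (ms @ [m]) \<and> safe_position S (ms @ [m])"
proof -
  let ?A = "self_intersections S" and ?B = "non_self_intersections S"
  note fin = finite_intersections[OF S(1)]
  note disj = self_intersections_disjoint[OF S(1)]
  show ?thesis
  proof (cases "odd (card (unresolved ?A ms))")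
    case True
    then obtain p where p: "p \<in> unresolved ?A ms" by fastforce
    obtain x where x: "x \<in> strands S p"
      using p crossing_strand[of p S] by (auto simp: unresolved_def crossings_eq)
    have "p \<notin> ?B" using p disj by (auto simp: unresolved_def)
    then have "unresolved ?B (ms @ [(p, x)]) = unresolved ?B ms"
      "first_over S (ms @ [(p, x)]) = first_over S ms"
      by (auto simp: first_over_snoc unresolved_def)
    then have "safe_position S (ms @ [(p, x)])"
      using thr True card_unresolved_snoc(1)[OF fin(1) p, of x]
      by (auto simp: safe_position_def threatened_position_def)
    moreover have "legal_play S (ms @ [(p, x)])"
      using legal p x by (auto simp: legal_play_snoc unresolved_def crossings_eq)
    ultimately show ?thesis by blast
  next
    case False
    then have odd: "odd (card (unresolved ?B ms))"
      using thr by (auto simp: threatened_position_def)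
    then obtain p where p: "p \<in> unresolved ?B ms" by fastforce
    then have pB: "p \<in> ?B" and new: "p \<notin> first_over S ms"
      by (force simp: unresolved_def first_over_def)+
    have fin_over: "finite (first_over S ms)" using fin(2) by (simp add: first_over_def)
    \<comment> \<open>Component 0 on top adds \<open>p\<close> to \<open>first_over\<close>,
      component 1 does not. The choice makes the count odd after every such move, in particular
      after the last.\<close>
    define i :: nat where "i = (if odd (card (first_over S ms)) then 1 else 0)"
    obtain x where x: "x \<in> strands S p" "fst x = i"
      using non_self_intersection_strand[OF S(2) pB, of i] unfolding i_def by force
    have "p \<notin> unresolved ?A ms" using pB disj by (auto simp: unresolved_def)
    then have "unresolved ?A (ms @ [(p, x)]) = unresolved ?A ms"
      by (rule card_unresolved_snoc(2)[OF fin(1)])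
    moreover have "odd (card (first_over S (ms @ [(p, x)])))"
      using new fin_over pB x by (simp add: first_over_snoc i_def)
    ultimately have "safe_position S (ms @ [(p, x)])"
      using False odd card_unresolved_snoc(1)[OF fin(2) p, of x]
      by (auto simp: safe_position_def)
    moreover have "legal_play S (ms @ [(p, x)])"
      using legal p x by (auto simp: legal_play_snoc unresolved_def crossings_eq)
    ultimately show ?thesis by blast
  qed
qed

section \<open>The strategy and its invariant\<close>

lemma legal_move_exists:
  assumes "legal_play S ms" "\<not> complete_play S ms"
  shows "\<exists>m. legal_play S (ms @ [m])"
proof -
  have "fst ` set ms \<subseteq> crossings S" using assms(1) by (auto simp: legal_play_def)
  then obtain p where "p \<in> unresolved (crossings S) ms"
    using assms by (auto simp: complete_play_def unresolved_def)
  moreover from this obtain x where "x \<in> strands S p"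
    using crossing_strand[of p S] by (auto simp: unresolved_def)
  ultimately show ?thesis using assms(1) legal_play_snoc by blast
qed

text \<open>\<open>winning_strategy\<close> demands a legal move in every incomplete play with the
  Linker to move, so some legal move is taken even where the position is not threatened.\<close>

definition linker_strategy :: "shadow \<Rightarrow> move list \<Rightarrow> move" where
  "linker_strategy S ms =
     (SOME m. legal_play S (ms @ [m]) \<and> (threatened_position S ms \<longrightarrow> safe_position S (ms @ [m])))"

lemma linker_strategy:
  assumes "link_shadow S" "length S = 2" "legal_play S ms" "\<not> complete_play S ms"
  shows "legal_play S (ms @ [linker_strategy S ms])"
    and "threatened_position S ms \<Longrightarrow> safe_position S (ms @ [linker_strategy S ms])"
proof -
  have "\<exists>m. legal_play S (ms @ [m]) \<and> (threatened_position S ms \<longrightarrow> safe_position S (ms @ [m]))"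
    using safe_after_threatened[OF assms(1,2) _ assms(3)] legal_move_exists[OF assms(3,4)] by blast
  from someI_ex[OF this]
  show "legal_play S (ms @ [linker_strategy S ms])"
    and "threatened_position S ms \<Longrightarrow> safe_position S (ms @ [linker_strategy S ms])"
    unfolding linker_strategy_def by blast+
qed

lemma follows_snoc:
  "follows P first \<sigma> (ms @ [m]) \<longleftrightarrow>
     follows P first \<sigma> ms \<and> (to_move first (length ms) = P \<longrightarrow> m = \<sigma> ms)"
  by (auto simp: follows_def less_Suc_eq nth_append)

lemma to_move_Suc: "to_move first (Suc k) = opponent (to_move first k)"
  by (cases first) (auto simp: to_move_def)

lemma legal_play_butlast: "legal_play S (ms @ [m]) \<Longrightarrow> legal_play S ms \<and> \<not> complete_play S ms"
  by (cases m) (auto simp: legal_play_snoc complete_play_def unresolved_def)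

text \<open>Induction on the play: moves of the Unlinker are covered by
  \<open>threatened_after_safe\<close>, those of the Linker by the choice in
  \<open>linker_strategy\<close>.\<close>

lemma linker_strategy_invariant:
  assumes S: "link_shadow S" "length S = 2"
    and start: "case first of Unlinker \<Rightarrow> safe_position S [] | Linker \<Rightarrow> threatened_position S []"
    and "legal_play S ms" "follows Linker first (linker_strategy S) ms"
  shows "case to_move first (length ms) of
      Unlinker \<Rightarrow> safe_position S ms | Linker \<Rightarrow> threatened_position S ms"
  using assms(4,5)
proof (induction ms rule: rev_induct)
  case Nil
  then show ?case using start by (simp add: to_move_def)
next
  case (snoc m ms)
  have legal: "legal_play S ms" "\<not> complete_play S ms"
    using legal_play_butlast[OF snoc.prems(1)] by auto
  have fol: "follows Linker first (linker_strategy S) ms"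
    "to_move first (length ms) = Linker \<Longrightarrow> m = linker_strategy S ms"
    using snoc.prems(2) by (auto simp: follows_snoc)
  have IH: "case to_move first (length ms) of
      Unlinker \<Rightarrow> safe_position S ms | Linker \<Rightarrow> threatened_position S ms"
    using snoc.IH legal(1) fol(1) by blast
  show ?case
  proof (cases "to_move first (length ms)")
    case Linker
    then show ?thesis
      using IH fol linker_strategy(2)[OF S legal] by (simp add: to_move_Suc)
  next
    case Unlinker
    then show ?thesis
      using IH threatened_after_safe[OF S(1) _ snoc.prems(1)] by (simp add: to_move_Suc)
  qed
qed

text \<open>With an odd number of non-self-intersections every complete play is unsplittable, so the
  starting position matters in the even case only.\<close>

lemma linker_strategy_wins:
  assumes S: "link_shadow S" "length S = 2"
    and start: "odd (card (non_self_intersections S)) \<or>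
      (case first of Unlinker \<Rightarrow> safe_position S [] | Linker \<Rightarrow> threatened_position S [])"
  shows "winning_strategy Linker first S (linker_strategy S)"
  unfolding winning_strategy_def
proof (intro conjI allI impI; elim conjE)
  fix ms assume "legal_play S ms" "\<not> complete_play S ms"
  then show "legal_play S (ms @ [linker_strategy S ms])" by (rule linker_strategy(1)[OF S])
next
  fix ms assume ms: "complete_play S ms" and fol: "follows Linker first (linker_strategy S) ms"
  have legal: "legal_play S ms" and compl: "fst ` set ms = crossings S"
    using ms by (auto simp: complete_play_def)
  have "odd (card (first_over S ms)) \<or> odd (card (non_self_intersections S))"
  proof (cases "odd (card (non_self_intersections S))")
    case False
    \<comment> \<open>Nothing is left unresolved, so the clause on \<open>first_over\<close> applies
      whoever would be to move.\<close>
    have res: "unresolved (self_intersections S) ms = {}" "unresolved (non_self_intersections S) ms = {}"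
      using compl by (auto simp: unresolved_def crossings_eq)
    have "case to_move first (length ms) of
        Unlinker \<Rightarrow> safe_position S ms | Linker \<Rightarrow> threatened_position S ms"
      using linker_strategy_invariant[OF S _ legal fol] start False by blast
    then show ?thesis
      using res by (auto simp: safe_position_def threatened_position_def split: player.splits)
  qed simp
  then show "wins Linker S ms" using unsplittable_final_diagram[OF S ms] by simp
qed

text \<open>If the number of non-self-intersections is even, the empty play is safe: its last clause
  is vacuous because some of them are unresolved.\<close>

lemma linker_strategy_wins_second:
  assumes "link_shadow S" "length S = 2" "non_self_intersections S \<noteq> {}"
    and "even (card (self_intersections S))"
  shows "winning_strategy Linker Unlinker S (linker_strategy S)"
  using assms by (intro linker_strategy_wins) (auto simp: safe_position_def unresolved_def)

text \<open>If the number of non-self-intersections is even, the self-intersections make the sum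
  odd, so the empty play is threatened.\<close>

lemma linker_strategy_wins_first:
  assumes "link_shadow S" "length S = 2" "non_self_intersections S \<noteq> {}"
    and "odd (card (self_intersections S))"
  shows "winning_strategy Linker Linker S (linker_strategy S)"
  using assms by (intro linker_strategy_wins) (auto simp: threatened_position_def unresolved_def)

section \<open>Shrinking a compact set by an ambient isotopy\<close>

lemma has_field_derivative_max_zero_square:
  "((\<lambda>x::real. (max 0 x)\<^sup>2) has_field_derivative 2 * max 0 x) (at x)"
proof -
  consider "x > 0" | "x < 0" | "x = 0" by linarith
  then show ?thesis
  proof cases
    case 1
    have "((\<lambda>x::real. x\<^sup>2) has_field_derivative 2 * max 0 x) (at x)"
      using 1 by (auto intro!: derivative_eq_intros)
    then show ?thesis
      by (rule has_field_derivative_transform_within_open[of _ _ _ "{0<..}"]) (use 1 in auto)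
  next
    case 2
    have "((\<lambda>x::real. 0) has_field_derivative 2 * max 0 x) (at x)"
      using 2 by (auto intro!: derivative_eq_intros)
    then show ?thesis
      by (rule has_field_derivative_transform_within_open[of _ _ _ "{..<0}"]) (use 2 in auto)
  next
    case 3
    \<comment> \<open>At the kink the difference quotient is \<open>max 0 h\<close>, which tends to
      0.\<close>
    have "((\<lambda>h::real. max 0 h) \<longlongrightarrow> max 0 0) (at 0)"
      by (intro tendsto_intros)
    moreover have "((max 0 (0 + h))\<^sup>2 - (max 0 0)\<^sup>2) / h = max 0 h" if "h \<noteq> 0" for h :: real
      using that by (auto simp: max_def power2_eq_square)
    ultimately have "((\<lambda>h::real. ((max 0 (0 + h))\<^sup>2 - (max 0 0)\<^sup>2) / h) \<longlongrightarrow> 0) (at 0)"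
      by (subst tendsto_cong[where g = "\<lambda>h. max 0 h"]) (auto simp: eventually_at_filter)
    then show ?thesis using 3 by (simp add: DERIV_def)
  qed
qed

text \<open>
  The factor is \<open>C\<^sup>1\<close> and increasing in \<open>r\<close>, so that however large \<open>c\<close> is, the radial map below is
  strictly increasing in the modulus.
\<close>

definition squeeze_factor :: "real \<Rightarrow> real \<Rightarrow> real \<Rightarrow> real \<Rightarrow> real" where
  "squeeze_factor \<sigma> c t r = exp (- (t * c * (max 0 (\<sigma> - r\<^sup>2))\<^sup>2))"

text \<open>\<open>t\<close> is the time, \<open>\<sigma>\<close> the square of the radius beyond
  which nothing moves, and \<open>c\<close> the strength of the contraction.\<close>

definition squeeze :: "real \<Rightarrow> real \<Rightarrow> real \<Rightarrow> complex \<Rightarrow> complex" where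
  "squeeze \<sigma> c t z = squeeze_factor \<sigma> c t (norm z) *\<^sub>R z"

text \<open>The rank-one term comes from the exponential; its factor 4 is 2 from the square of
  \<open>max\<close> and 2 from the square of the modulus.\<close>

definition squeeze_deriv :: "real \<Rightarrow> real \<Rightarrow> real \<Rightarrow> complex \<Rightarrow> complex \<Rightarrow> complex" where
  "squeeze_deriv \<sigma> c t z h = squeeze_factor \<sigma> c t (norm z) *\<^sub>R
     (h + (4 * t * c * max 0 (\<sigma> - (norm z)\<^sup>2) * (z \<bullet> h)) *\<^sub>R z)"

lemma squeeze_has_derivative:
  "(squeeze \<sigma> c t has_derivative squeeze_deriv \<sigma> c t z) (at z)"
proof -
  \<comment> \<open>The squared modulus is written as \<open>z \<bullet> z\<close>, whose derivative
    needs no special case at 0.\<close>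
  let ?m = "\<lambda>z::complex. exp (- (t * c * (max 0 (\<sigma> - z \<bullet> z))\<^sup>2))"
  have "((\<lambda>z::complex. \<sigma> - z \<bullet> z) has_derivative (\<lambda>h. - 2 * (z \<bullet> h))) (at z)"
    by (auto intro!: derivative_eq_intros simp: inner_commute)
  then have "((\<lambda>z. (max 0 (\<sigma> - z \<bullet> z))\<^sup>2) has_derivative
      (\<lambda>h. 2 * max 0 (\<sigma> - z \<bullet> z) * (- 2 * (z \<bullet> h)))) (at z)"
    using has_field_derivative_max_zero_square[of "\<sigma> - z \<bullet> z"] unfolding has_field_derivative_def
    by (rule has_derivative_compose)
  moreover have "((\<lambda>z. exp (- (t * c * q z)) *\<^sub>R z) has_derivative
      (\<lambda>h. exp (- (t * c * q z)) *\<^sub>R h + (exp (- (t * c * q z)) * - (t * c * q' h)) *\<^sub>R z)) (at z)"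
    if "(q has_derivative q') (at z)" for q q' :: "complex \<Rightarrow> real"
    using that by (auto intro!: derivative_eq_intros simp: algebra_simps)
  ultimately have "((\<lambda>z. ?m z *\<^sub>R z) has_derivative
      (\<lambda>h. ?m z *\<^sub>R h + (?m z * - (t * c * (2 * max 0 (\<sigma> - z \<bullet> z) * (- 2 * (z \<bullet> h))))) *\<^sub>R z)) (at z)"
    by blast
  moreover have "(\<lambda>z. ?m z *\<^sub>R z) = squeeze \<sigma> c t"
    by (auto simp: squeeze_def squeeze_factor_def dot_square_norm)
  moreover have "(\<lambda>h. ?m z *\<^sub>R h + (?m z * - (t * c * (2 * max 0 (\<sigma> - z \<bullet> z) * (- 2 * (z \<bullet> h))))) *\<^sub>R z)
      = squeeze_deriv \<sigma> c t z"
    by (auto simp: squeeze_deriv_def squeeze_factor_def dot_square_norm algebra_simps)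
  ultimately show ?thesis by simp
qed

text \<open>Pairing with \<open>z\<close> isolates \<open>z \<bullet> h\<close> times a positive
  number. So \<open>z \<bullet> h = 0\<close>, and the rank-one term disappears.\<close>

lemma squeeze_deriv_eq_0:
  assumes "t \<ge> 0" "c \<ge> 0" "squeeze_deriv \<sigma> c t z h = 0"
  shows "h = 0"
proof -
  define a where "a = 4 * t * c * max 0 (\<sigma> - (norm z)\<^sup>2)"
  have a: "a \<ge> 0" using assms by (simp add: a_def)
  have h: "h + (a * (z \<bullet> h)) *\<^sub>R z = 0"
    using assms(3) by (simp add: squeeze_deriv_def squeeze_factor_def a_def)
  then have "z \<bullet> (h + (a * (z \<bullet> h)) *\<^sub>R z) = 0" by simp
  then have "(z \<bullet> h) * (1 + a * (z \<bullet> z)) = 0"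
    by (simp add: inner_add_right algebra_simps)
  moreover have "1 + a * (z \<bullet> z) > 0" using a by (simp add: add_pos_nonneg)
  ultimately have "z \<bullet> h = 0" by simp
  then show ?thesis using h by simp
qed

lemma squeeze_eq_self: "\<sigma> \<le> (norm z)\<^sup>2 \<Longrightarrow> squeeze \<sigma> c t z = z"
  by (simp add: squeeze_def squeeze_factor_def)

lemma continuous_squeeze:
  "continuous_on UNIV (\<lambda>u. squeeze \<sigma> c (fst u) (snd u))"
  "continuous_on UNIV (\<lambda>u. squeeze_deriv \<sigma> c (fst u) (fst (snd u)) (snd (snd u)))"
  unfolding squeeze_def squeeze_deriv_def squeeze_factor_def by (intro continuous_intros)+

lemma norm_squeeze: "norm (squeeze \<sigma> c t z) = squeeze_factor \<sigma> c t (norm z) * norm z"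
  by (simp add: squeeze_def squeeze_factor_def)

lemma squeeze_factor_strict_mono:
  assumes "t \<ge> 0" "c \<ge> 0" "0 \<le> r" "r < s"
  shows "squeeze_factor \<sigma> c t r * r < squeeze_factor \<sigma> c t s * s"
proof -
  have "r\<^sup>2 \<le> s\<^sup>2" using assms by (simp add: power_mono)
  then have "(max 0 (\<sigma> - s\<^sup>2))\<^sup>2 \<le> (max 0 (\<sigma> - r\<^sup>2))\<^sup>2" by (intro power_mono) auto
  then have "squeeze_factor \<sigma> c t r \<le> squeeze_factor \<sigma> c t s"
    unfolding squeeze_factor_def using assms by (simp add: mult_left_mono)
  moreover have "squeeze_factor \<sigma> c t s > 0" by (simp add: squeeze_factor_def)
  ultimately show ?thesis using assms by (intro mult_le_less_imp_less) (auto simp: squeeze_factor_def)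
qed

text \<open>Rays from 0 are preserved, so everything reduces to the radial function
  \<open>?\<phi>\<close>, which is continuous and strictly increasing from 0 at 0 to 1 at 1.\<close>

lemma bij_betw_squeeze:
  assumes t: "t \<ge> 0" "c \<ge> 0" and \<sigma>: "\<sigma> \<le> 1"
  shows "bij_betw (squeeze \<sigma> c t) (ball 0 1) (ball 0 1)"
proof -
  let ?\<phi> = "\<lambda>r. squeeze_factor \<sigma> c t r * r"
  have one: "?\<phi> 1 = 1" using \<sigma> by (simp add: squeeze_factor_def)
  have inj: "inj (squeeze \<sigma> c t)"
  proof (rule injI)
    fix z w assume eq: "squeeze \<sigma> c t z = squeeze \<sigma> c t w"
    then have "?\<phi> (norm z) = ?\<phi> (norm w)" by (metis norm_squeeze)
    then have "norm z = norm w"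
      using squeeze_factor_strict_mono[OF t, of "norm z" "norm w" \<sigma>]
        squeeze_factor_strict_mono[OF t, of "norm w" "norm z" \<sigma>] by fastforce
    then show "z = w" using eq by (simp add: squeeze_def squeeze_factor_def)
  qed
  have "squeeze \<sigma> c t z \<in> ball 0 1" if "z \<in> ball 0 1" for z
    using squeeze_factor_strict_mono[OF t, of "norm z" 1 \<sigma>] that one by (simp add: norm_squeeze)
  moreover have "w \<in> squeeze \<sigma> c t ` ball 0 1" if w: "w \<in> ball 0 1" for w
  proof (cases "w = 0")
    case True
    then show ?thesis by (auto simp: squeeze_def intro!: image_eqI[of _ _ 0])
  next
    case False
    have "continuous_on {0..1} ?\<phi>" unfolding squeeze_factor_def by (intro continuous_intros)
    then obtain r where r: "0 \<le> r" "r \<le> 1" "?\<phi> r = norm w"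
      using IVT'[of ?\<phi> 0 "norm w" 1] one w by auto
    define z where "z = (r / norm w) *\<^sub>R w"
    have "norm z = r" using r False by (simp add: z_def)
    then have "squeeze \<sigma> c t z = (?\<phi> r / norm w) *\<^sub>R w" by (simp add: squeeze_def z_def)
    then have "squeeze \<sigma> c t z = w" using r False by simp
    moreover have "r \<noteq> 1" using r one w by auto
    ultimately show ?thesis using r \<open>norm z = r\<close> by (intro image_eqI[of _ _ z]) auto
  qed
  ultimately show ?thesis using inj by (auto simp: bij_betw_def inj_on_subset[OF inj])
qed

text \<open>
  The radial contraction is conjugated by a Riemann map of \<open>U\<close>; it is the identity near the unit
  circle, so it extends by the identity outside \<open>U\<close>.
\<close>

lemma shrinking_isotopy:
  assumes U: "open U" "simply_connected U" "U \<noteq> UNIV" and K: "compact K" "K \<subseteq> U" "K \<noteq> {}"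
  obtains H p e where "ambient_isotopy H" "0 < e" "cball p e \<subseteq> U" "H 1 ` K \<subseteq> ball p e"
    "\<And>t z. z \<notin> U \<Longrightarrow> H t z = z"
proof -
  obtain f k where f: "f holomorphic_on U" and k: "k holomorphic_on ball 0 1"
    and fU: "\<And>z. z \<in> U \<Longrightarrow> f z \<in> ball 0 1" and kf: "\<And>z. z \<in> U \<Longrightarrow> k (f z) = z"
    and kU: "\<And>z. z \<in> ball 0 1 \<Longrightarrow> k z \<in> U" and fk: "\<And>z. z \<in> ball 0 1 \<Longrightarrow> f (k z) = z"
  proof -
    have "\<exists>f k. f holomorphic_on U \<and> k holomorphic_on ball 0 1 \<and>
        (\<forall>z\<in>U. f z \<in> ball 0 1 \<and> k (f z) = z) \<and> (\<forall>z\<in>ball 0 1. k z \<in> U \<and> f (k z) = z)"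
      using Riemann_mapping_theorem[of U] U K by blast
    then show ?thesis using that by blast
  qed
  have cont_f: "continuous_on U f" and cont_k: "continuous_on (ball 0 1) k"
    using f k by (auto intro: holomorphic_on_imp_continuous_on)
  have "compact (f ` K)" using K cont_f by (meson compact_continuous_image continuous_on_subset)
  then obtain w where w: "w \<in> f ` K" "\<And>z. z \<in> f ` K \<Longrightarrow> norm z \<le> norm w"
    using continuous_attains_sup[of "f ` K" norm] K(3) by (auto intro: continuous_intros)
  \<comment> \<open>The least radius of a closed disc about 0 that contains the image of
    \<open>K\<close> under \<open>f\<close>; compactness puts it below 1.\<close>
  define r where "r = norm w"
  have "0 \<le> r" "r < 1" using w(1) fU K(2) by (auto simp: r_def)
  then have "r\<^sup>2 < 1" by (simp add: power_less_one_iff abs_square_less_1)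
  \<comment> \<open>\<open>sqrt \<sigma>\<close> exceeds \<open>r\<close>, so that the factor can be
    made small on the whole image of \<open>K\<close>, and is below 1, so that nothing moves near
    the unit circle.\<close>
  then obtain \<sigma> where \<sigma>: "r\<^sup>2 < \<sigma>" "\<sigma> < 1" using dense by blast
  \<comment> \<open>The target disc is centred at the point that \<open>f\<close> sends to 0;
    \<open>k\<close> maps points of modulus below \<open>d\<close> into it.\<close>
  have "k 0 \<in> U" using kU by simp
  then obtain e where e: "0 < e" "cball (k 0) e \<subseteq> U" using U(1) open_contains_cball by blast
  have "isCont k 0" using cont_k by (simp add: continuous_on_eq_continuous_at)
  then obtain d where d: "0 < d" "\<And>z. norm z < d \<Longrightarrow> dist (k z) (k 0) < e"
    using e(1) unfolding continuous_at_eps_delta by (metis diff_zero dist_norm)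
  define a where "a = (\<sigma> - r\<^sup>2)\<^sup>2"
  \<comment> \<open>At time 1 points of modulus at most \<open>r\<close> are scaled by at most
    \<open>exp (- (c * a)) = exp (- \<bar>ln d\<bar>) \<le> d\<close>. The absolute value keeps
    \<open>c\<close> nonnegative when \<open>d > 1\<close>.\<close>
  define c where "c = \<bar>ln d\<bar> / a"
  have "a > 0" using \<sigma> by (simp add: a_def)
  then have c: "c \<ge> 0" "exp (- (c * a)) \<le> d"
  proof -
    show "c \<ge> 0" using \<open>a > 0\<close> by (simp add: c_def)
    have "exp (- (c * a)) \<le> exp (ln d)" using \<open>a > 0\<close> by (simp add: c_def)
    then show "exp (- (c * a)) \<le> d" using d(1) by simp
  qed
  define G where "G = squeeze \<sigma> c"
  define G' where "G' = squeeze_deriv \<sigma> c"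
  have bij_G: "bij_betw (G t) (ball 0 1) (ball 0 1)" if "0 \<le> t" for t
    using bij_betw_squeeze[of t c \<sigma>] that c \<sigma> by (simp add: G_def)
  define H where "H t z = (if z \<in> U then k (G t (f z)) else z)" for t z
  define L where "L t z h = (if z \<in> U then deriv k (G t (f z)) * G' t (f z) (deriv f z * h) else h)"
    for t z h
  \<comment> \<open>Nothing moves outside \<open>C\<close>. As \<open>C\<close> is a compact subset
    of \<open>U\<close>, the open sets \<open>U\<close> and \<open>- C\<close> cover the plane, and
    regularity is checked on each.\<close>
  define C where "C = k ` cball 0 (sqrt \<sigma>)"
  have "0 \<le> \<sigma>" using \<sigma>(1) zero_le_power2[of r] by linarith
  have sqrt: "cball 0 (sqrt \<sigma>) \<subseteq> ball (0::complex) 1"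
    using \<sigma> by (simp add: cball_subset_ball_iff)
  have "compact C" unfolding C_def
    using cont_k sqrt by (intro compact_continuous_image) (auto intro: continuous_on_subset)
  then have open_C: "open (- C)" by (simp add: compact_imp_closed open_Compl)
  have CU: "C \<subseteq> U" using sqrt kU by (auto simp: C_def)
  have G_in: "G t w \<in> ball 0 1" if "w \<in> ball 0 1" "0 \<le> t" for t w
    using bij_G[OF that(2)] that by (auto simp: bij_betw_def)
  have H_id: "H t z = z" if "z \<notin> C" for t z
  proof (cases "z \<in> U")
    case True
    have "sqrt \<sigma> < norm (f z)"
    proof (rule ccontr)
      assume "\<not> ?thesis"
      then have "f z \<in> cball 0 (sqrt \<sigma>)" by simp
      then show False using that kf[OF True] unfolding C_def by (metis imageI)
    qed
    then have "\<sigma> \<le> (norm (f z))\<^sup>2" using \<open>0 \<le> \<sigma>\<close> by (simp add: real_le_lsqrt sqrt_le_D)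
    then show ?thesis using True kf by (simp add: H_def G_def squeeze_eq_self)
  qed (simp add: H_def)
  have deriv_U: "(H t has_derivative L t z) (at z)" if "z \<in> U" "0 \<le> t" for t z
  proof -
    have "(f has_derivative (\<lambda>h. deriv f z * h)) (at z)"
      using holomorphic_derivI[OF f U(1) that(1)] by (simp add: has_field_derivative_def)
    moreover have "(G t has_derivative G' t (f z)) (at (f z))"
      unfolding G_def G'_def by (rule squeeze_has_derivative)
    ultimately have "((\<lambda>z. G t (f z)) has_derivative (\<lambda>h. G' t (f z) (deriv f z * h))) (at z)"
      by (rule has_derivative_compose)
    moreover have "(k has_derivative (\<lambda>h. deriv k (G t (f z)) * h)) (at (G t (f z)))"
      using holomorphic_derivI[OF k open_ball G_in[OF fU[OF that(1)] that(2)]]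
      by (simp add: has_field_derivative_def)
    ultimately have "((\<lambda>z. k (G t (f z))) has_derivative
        (\<lambda>h. deriv k (G t (f z)) * G' t (f z) (deriv f z * h))) (at z)"
      by (rule has_derivative_compose)
    moreover have "(\<lambda>h. deriv k (G t (f z)) * G' t (f z) (deriv f z * h)) = L t z"
      using that by (simp add: L_def fun_eq_iff)
    ultimately have "((\<lambda>z. k (G t (f z))) has_derivative L t z) (at z)" by simp
    then show ?thesis
      by (rule has_derivative_transform_within_open[OF _ U(1) that(1)]) (simp add: H_def)
  qed
  have deriv_C: "(H t has_derivative (\<lambda>h. h)) (at z)" if "z \<notin> C" for t z
    by (rule has_derivative_transform_within_open[OF has_derivative_ident open_C]) (use that H_id in auto)
  \<comment> \<open>Where \<open>U\<close> and \<open>- C\<close> overlap, both formulas are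
    derivatives of the same map, so they agree.\<close>
  have L_C: "L t z = (\<lambda>h. h)" if "z \<notin> C" "0 \<le> t" for t z
  proof (cases "z \<in> U")
    case True
    show ?thesis using has_derivative_unique[OF deriv_U[OF True that(2)] deriv_C[OF that(1)]] .
  qed (simp add: L_def fun_eq_iff)
  have deriv_H: "(H t has_derivative L t z) (at z)" if "0 \<le> t" for t z
    using deriv_U deriv_C L_C that CU by (metis subsetD)
  define H' where "H' t z = Blinfun (L t z)" for t z
  have H'_apply: "blinfun_apply (H' t z) = L t z" if "0 \<le> t" for t z
    unfolding H'_def using deriv_H[OF that]
    by (intro bounded_linear_Blinfun_apply) (rule has_derivative_bounded_linear)
  have inj_L: "inj (L t z)" if "0 \<le> t" for t z
  proof (cases "z \<in> U")
    case True
    let ?w = "G t (f z)"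
    have "?w \<in> ball 0 1" using G_in fU True that by blast
    \<comment> \<open>\<open>f\<close> and \<open>k\<close> are mutually inverse, so their
      derivatives vanish nowhere.\<close>
    then have "deriv k ?w * deriv f (k ?w) = 1"
      using deriv_left_inverse[OF k f open_ball U(1)] kU fk by blast
    moreover have "deriv f z * deriv k (f z) = 1"
      using deriv_left_inverse[OF f k U(1) open_ball] fU kf True by blast
    ultimately have nz: "deriv k ?w \<noteq> 0" "deriv f z \<noteq> 0" by auto
    have "h = 0" if "L t z h = 0" for h
    proof -
      have "G' t (f z) (deriv f z * h) = 0" using that nz True by (simp add: L_def)
      then have "deriv f z * h = 0"
        using squeeze_deriv_eq_0 \<open>0 \<le> t\<close> c(1) unfolding G'_def by blast
      then show ?thesis using nz by simp
    qed
    then show ?thesis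
      using linear_injective_0[OF has_derivative_linear[OF deriv_H[OF that]]] by blast
  next
    case False
    then show ?thesis by (simp add: L_def inj_def)
  qed
  have cover: "UNIV = U \<union> - C" using CU by auto
  have glue: "continuous_on ({0..1} \<times> UNIV) F"
    if "continuous_on ({0..1} \<times> U) F" "continuous_on ({0..1} \<times> (- C)) F"
    for F :: "real \<times> complex \<Rightarrow> complex"
  proof -
    have "{0..1} \<times> UNIV = {0..1} \<times> U \<union> {0..1::real} \<times> (- C)" using cover by auto
    moreover have "openin (top_of_set ({0..1} \<times> UNIV)) ({0..1::real} \<times> V)" if "open V"
      for V :: "complex set"
      using that by (auto simp: openin_open intro!: exI[of _ "UNIV \<times> V"] open_Times)
    ultimately show ?thesis
      using continuous_on_Un_local_open[of "{0..1} \<times> U" "{0..1} \<times> (- C)" F] that U(1) open_C by metis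
  qed
  have fst_snd: "continuous_on ({0..1} \<times> U) (\<lambda>u::real \<times> complex. f (snd u))"
    by (rule continuous_on_compose2[OF cont_f]) (auto intro: continuous_intros)
  have cont_G: "continuous_on ({0..1} \<times> U) (\<lambda>u. G (fst u) (f (snd u)))"
    unfolding G_def
    by (rule continuous_on_compose2[OF continuous_squeeze(1), of _ "\<lambda>u. (fst u, f (snd u))", simplified])
       (intro continuous_intros fst_snd)
  have G_ball: "(\<lambda>u. G (fst u) (f (snd u))) ` ({0..1} \<times> U) \<subseteq> ball 0 1"
    using G_in fU by fastforce
  have cont_H: "continuous_on ({0..1} \<times> UNIV) (\<lambda>(t, z). H t z)"
  proof (rule glue)
    have "continuous_on ({0..1} \<times> U) (\<lambda>u. k (G (fst u) (f (snd u))))"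
      by (rule continuous_on_compose2[OF cont_k cont_G G_ball])
    then show "continuous_on ({0..1} \<times> U) (\<lambda>(t, z). H t z)"
      by (rule continuous_on_eq) (auto simp: H_def)
    show "continuous_on ({0..1} \<times> (- C)) (\<lambda>(t, z). H t z)"
      by (rule continuous_on_eq[OF continuous_on_snd[OF continuous_on_id]]) (auto simp: H_id)
  qed
  have cont_L: "continuous_on ({0..1} \<times> UNIV) (\<lambda>(t, z). L t z h)" for h
  proof (rule glue)
    have df: "continuous_on U (deriv f)" and dk: "continuous_on (ball 0 1) (deriv k)"
      using f k U(1) by (auto intro!: holomorphic_on_imp_continuous_on holomorphic_deriv)
    have cont_df: "continuous_on ({0..1} \<times> U) (\<lambda>u::real \<times> complex. deriv f (snd u))"
      by (rule continuous_on_compose2[OF df]) (auto intro: continuous_intros)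
    have "continuous_on ({0..1} \<times> U) (\<lambda>u. deriv k (G (fst u) (f (snd u))))"
      by (rule continuous_on_compose2[OF dk cont_G G_ball])
    moreover have "continuous_on ({0..1} \<times> U) (\<lambda>u. G' (fst u) (f (snd u)) (deriv f (snd u) * h))"
      unfolding G'_def
      by (rule continuous_on_compose2[OF continuous_squeeze(2),
            of _ "\<lambda>u. (fst u, f (snd u), deriv f (snd u) * h)", simplified])
         (intro continuous_intros fst_snd cont_df)
    ultimately have "continuous_on ({0..1} \<times> U)
        (\<lambda>u. deriv k (G (fst u) (f (snd u))) * G' (fst u) (f (snd u)) (deriv f (snd u) * h))"
      by (rule continuous_on_mult)
    then show "continuous_on ({0..1} \<times> U) (\<lambda>(t, z). L t z h)"
      by (rule continuous_on_eq) (auto simp: L_def)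
    show "continuous_on ({0..1} \<times> (- C)) (\<lambda>(t, z). L t z h)"
      by (rule continuous_on_eq[OF continuous_on_const[of _ h]]) (auto simp: L_C)
  qed
  \<comment> \<open>In finite dimension continuity in operator norm follows from continuity of
    \<open>L t z h\<close> for each fixed \<open>h\<close>.\<close>
  have cont_H': "continuous_on ({0..1} \<times> UNIV) (\<lambda>(t, z). H' t z)"
  proof (rule continuous_on_blinfun_componentwise)
    fix i :: complex
    show "continuous_on ({0..1} \<times> UNIV) (\<lambda>u. blinfun_apply (case u of (t, z) \<Rightarrow> H' t z) i)"
      by (rule continuous_on_eq[OF cont_L[of i]]) (auto simp: H'_apply)
  qed
  have bij_H: "bij (H t)" if "0 \<le> t" for t
  proof -
    have "bij_betw f U (ball 0 1)"
      by (rule bij_betw_byWitness[of _ k]) (use fU kf kU fk in auto)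
    moreover have "bij_betw k (ball 0 1) U"
      by (rule bij_betw_byWitness[of _ f]) (use fU kf kU fk in auto)
    ultimately have "bij_betw (k \<circ> G t \<circ> f) U U"
      using bij_G[OF that] by (metis bij_betw_trans comp_assoc)
    then have "bij_betw (H t) U U"
      by (subst bij_betw_cong[of _ _ "k \<circ> G t \<circ> f"]) (simp_all add: H_def)
    moreover have "bij_betw (H t) (- U) (- U)"
      by (subst bij_betw_cong[of _ _ id]) (simp_all add: H_def)
    ultimately have "bij_betw (H t) (U \<union> - U) (U \<union> - U)"
      by (rule bij_betw_combine) auto
    then show ?thesis by simp
  qed
  have "H 0 z = z" for z
    using kf by (simp add: H_def G_def squeeze_def squeeze_factor_def)
  then have "ambient_isotopy H"
    unfolding ambient_isotopy_def using cont_H cont_H' bij_H deriv_H inj_L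
    by (intro conjI allI ballI exI[of _ H']) (auto simp: H'_apply)
  moreover have "H 1 z \<in> ball (k 0) e" if "z \<in> K" for z
  proof -
    have zU: "z \<in> U" using that K by blast
    have nz: "norm (f z) \<le> r" using w(2) that by (simp add: r_def)
    then have "\<sigma> - r\<^sup>2 \<le> max 0 (\<sigma> - (norm (f z))\<^sup>2)"
      by (smt (verit) norm_ge_zero power_mono)
    then have "a \<le> (max 0 (\<sigma> - (norm (f z))\<^sup>2))\<^sup>2"
      unfolding a_def using \<sigma> by (intro power_mono) auto
    then have "squeeze_factor \<sigma> c 1 (norm (f z)) \<le> exp (- (c * a))"
      using c(1) by (simp add: squeeze_factor_def mult_left_mono)
    then have "squeeze_factor \<sigma> c 1 (norm (f z)) \<le> d" using c(2) by linarith
    \<comment> \<open>The image of \<open>K\<close> ends up within modulus \<open>d * r < d\<close>,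
      which \<open>k\<close> maps into the target disc.\<close>
    then have "norm (G 1 (f z)) \<le> d * r"
      unfolding G_def norm_squeeze using nz d(1) by (intro mult_mono) auto
    also have "d * r < d" using d(1) \<open>r < 1\<close> by simp
    finally show ?thesis using d(2)[of "G 1 (f z)"] zU by (simp add: H_def dist_commute)
  qed
  moreover have "H t z = z" if "z \<notin> U" for t z using that by (simp add: H_def)
  ultimately show ?thesis using that[OF _ e] by blast
qed

section \<open>Simply connected open sets separating two continua\<close>

lemma simply_connected_component:
  fixes T :: "complex set"
  assumes T: "closed T" "connected T" and U: "U \<in> components (- T)" "\<not> bounded (- U)"
  shows "open U \<and> simply_connected U"
proof -
  have "open U" using open_components[OF open_Compl[OF T(1)] U(1)] .
  have "connected U" using U(1) in_components_connected by blast
  have "connected (- U)" using component_complement_connected[OF T(2) U(1)] .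
  moreover have "- U \<noteq> {}" using U(2) by auto
  \<comment> \<open>The complement of \<open>U\<close> is connected and unbounded, so each of its
    components is unbounded. For an open connected planar set this is equivalent to simple
    connectivity.\<close>
  ultimately have "components (- U) = {- U}" by (simp add: components_eq_sing_iff)
  then show ?thesis
    using simply_connected_eq_unbounded_complement_components[OF \<open>open U\<close>] \<open>open U\<close> \<open>connected U\<close> U(2)
    by simp
qed

text \<open>
  Either one set lies in a bounded complementary component of the other, and that component will
  do, or \<open>K0\<close> can be joined to infinity without meeting \<open>K1\<close>.
\<close>

lemma separating_simply_connected:
  fixes K0 K1 :: "complex set"
  assumes K: "compact K0" "connected K0" "K0 \<noteq> {}" "compact K1" "connected K1" "K1 \<noteq> {}"
    and disj: "K0 \<inter> K1 = {}"
  obtains U where "open U" "simply_connected U"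
    "K0 \<subseteq> U \<and> U \<inter> K1 = {} \<or> K1 \<subseteq> U \<and> U \<inter> K0 = {}"
proof -
  obtain a where a: "a \<in> K0" using K by blast
  define W where "W = connected_component_set (- K1) a"
  have W: "W \<in> components (- K1)" using a disj by (auto simp: W_def components_def)
  have K0W: "K0 \<subseteq> W"
    unfolding W_def using a K(2) disj by (intro connected_component_maximal) auto
  have W1: "W \<inter> K1 = {}" using in_components_subset[OF W] by auto
  show ?thesis
  proof (cases "bounded W")
    case True
    then have "\<not> bounded (- W)" using cobounded_imp_unbounded by blast
    then show ?thesis
      using that simply_connected_component[of K1 W] K W K0W W1 compact_imp_closed by metis
  next
    case False
    have "open W" using open_components[OF open_Compl[OF compact_imp_closed[OF K(4)]] W] .
    moreover have "connected W" using W in_components_connected by blast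
    ultimately have "path_connected W" by (simp add: connected_open_path_connected)
    obtain R where R: "K1 \<subseteq> ball 0 R" using K bounded_subset_ballD compact_imp_bounded by metis
    obtain q where q: "q \<in> W" "q \<notin> ball 0 R"
      using False bounded_subset[OF bounded_ball] by blast
    obtain g where g: "path g" "path_image g \<subseteq> W" "pathstart g = a" "pathfinish g = q"
      using \<open>path_connected W\<close> K0W a q unfolding path_connected_def by blast
    \<comment> \<open>\<open>T\<close> joins \<open>K0\<close> to the outside of the ball along a
      path that avoids \<open>K1\<close>. It is connected and contains everything far out, so the
      component of \<open>- T\<close> around \<open>K1\<close> is bounded.\<close>
    define T where "T = K0 \<union> path_image g \<union> - ball 0 R"
    have "a \<in> path_image g" "q \<in> path_image g"
      using g pathstart_in_path_image pathfinish_in_path_image by metis+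
    moreover have "connected (- ball (0::complex) R)"
      by (rule connected_complement_bounded_convex) auto
    ultimately have "connected T"
      unfolding T_def using a q(2) K(2) g(1)
      by (intro connected_Un connected_path_image) auto
    have "closed T"
      unfolding T_def using K(1) g(1)
      by (intro closed_Un compact_imp_closed[OF compact_path_image] closed_Compl) (auto simp: compact_imp_closed)
    have T1: "K1 \<subseteq> - T" using disj R g(2) W1 by (auto simp: T_def)
    obtain b where b: "b \<in> K1" using K by blast
    define U where "U = connected_component_set (- T) b"
    have U: "U \<in> components (- T)" using b T1 by (auto simp: U_def components_def)
    have "K1 \<subseteq> U"
      unfolding U_def using b K(5) T1 by (intro connected_component_maximal) auto
    have UT: "U \<subseteq> - T" using in_components_subset[OF U] .
    then have "U \<subseteq> ball 0 R" by (auto simp: T_def)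
    then have "bounded U" using bounded_ball bounded_subset by blast
    then have "\<not> bounded (- U)" using cobounded_imp_unbounded by blast
    then have "open U \<and> simply_connected U"
      using simply_connected_component[OF \<open>closed T\<close> \<open>connected T\<close> U] by blast
    moreover have "U \<inter> K0 = {}" using UT by (auto simp: T_def)
    ultimately show ?thesis using that \<open>K1 \<subseteq> U\<close> by blast
  qed
qed

section \<open>Splitting disjoint curves\<close>

lemma immersed_closed_curve_comp:
  assumes g: "immersed_closed_curve g"
    and F: "\<And>z. (F has_derivative blinfun_apply (F' z)) (at z)" "continuous_on UNIV F'"
      "\<And>z. inj (blinfun_apply (F' z))"
  shows "immersed_closed_curve (F \<circ> g)"
    and "vector_derivative (F \<circ> g) (at t) = F' (g t) (vector_derivative g (at t))"
proof -
  let ?v = "\<lambda>t. vector_derivative g (at t)"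
  have C1: "g C1_differentiable_on UNIV" using g by (simp add: immersed_closed_curve_def)
  then have gd: "(g has_vector_derivative ?v t) (at t)" for t
    by (auto simp: C1_differentiable_on_eq vector_derivative_works)
  have cont_v: "continuous_on UNIV ?v" using C1 by (simp add: C1_differentiable_on_eq)
  have cont_g: "continuous_on UNIV g" using C1 by (rule C1_differentiable_imp_continuous_on)
  have d: "((F \<circ> g) has_vector_derivative F' (g t) (?v t)) (at t)" for t
    using has_derivative_compose[OF gd[of t, unfolded has_vector_derivative_def] F(1)]
    by (simp add: has_vector_derivative_def o_def blinfun.scaleR_right)
  show vd: "vector_derivative (F \<circ> g) (at t) = F' (g t) (?v t)" for t
    using d by (rule vector_derivative_at)
  have "continuous_on UNIV (\<lambda>t. F' (g t))"
    using continuous_on_compose2[OF F(2) cont_g] by simp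
  then have "continuous_on UNIV (\<lambda>t. F' (g t) (?v t))"
    using cont_v by (rule blinfun.continuous_on)
  then have "(F \<circ> g) C1_differentiable_on UNIV"
    unfolding C1_differentiable_on_def using d
    by (intro exI[of _ "\<lambda>t. F' (g t) (?v t)"]) simp
  moreover have "F' (g t) (?v t) \<noteq> 0" for t
    using F(3)[of "g t"] g injD[of "blinfun_apply (F' (g t))" "?v t" 0]
    by (auto simp: immersed_closed_curve_def blinfun.zero_right)
  ultimately show "immersed_closed_curve (F \<circ> g)"
    using g vd by (simp add: immersed_closed_curve_def)
qed

text \<open>The strands stay the same and the points move. The injective linear map
  \<open>F' q\<close> carries independent tangents at \<open>q\<close> to independent tangents at
  \<open>F q\<close>.\<close>

lemma link_shadow_map_comp:
  assumes S: "link_shadow S" and "bij F"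
    and F: "\<And>z. (F has_derivative blinfun_apply (F' z)) (at z)" "continuous_on UNIV F'"
      "\<And>z. inj (blinfun_apply (F' z))"
  shows "link_shadow (map (\<lambda>g. F \<circ> g) S)" (is "link_shadow ?S'")
    and "crossings (map (\<lambda>g. F \<circ> g) S) = F ` crossings S"
proof -
  have imm: "immersed_closed_curve g" if "g \<in> set S" for g
    using S that by (simp add: link_shadow_def)
  have surj: "\<exists>q. p = F q" for p using \<open>bij F\<close> by (metis bij_is_surj surjD)
  have strands: "strands ?S' (F q) = strands S q" for q
    by (rule strands_map_comp[OF bij_is_inj[OF \<open>bij F\<close>]])
  show crossings: "crossings ?S' = F ` crossings S"
  proof (intro set_eqI)
    fix p
    obtain q where q: "p = F q" using surj by blast
    have "p \<in> crossings ?S' \<longleftrightarrow> q \<in> crossings S"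
      by (simp add: crossings_def q strands)
    then show "p \<in> crossings ?S' \<longleftrightarrow> p \<in> F ` crossings S"
      using q bij_is_inj[OF \<open>bij F\<close>] by (simp add: inj_image_mem_iff)
  qed
  have tangent: "tangent ?S' x = F' (proj S x) (tangent S x)" if "x \<in> strands S q" for x q
  proof -
    have "fst x < length S" using that by (auto simp: strands_def lpoints_def)
    then show ?thesis
      using immersed_closed_curve_comp(2)[OF imm F] by (simp add: tangent_def proj_def)
  qed
  have transverse: "tangent ?S' x \<notin> span {tangent ?S' y}"
    if "x \<in> strands ?S' r" "y \<in> strands ?S' r" "x \<noteq> y" for x y r
  proof
    obtain q where "r = F q" using surj by blast
    then have xy: "x \<in> strands S q" "y \<in> strands S q" "x \<noteq> y" using that strands by auto
    have p: "proj S x = q" "proj S y = q" using xy by (auto simp: strands_def)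
    assume "tangent ?S' x \<in> span {tangent ?S' y}"
    then obtain k where "tangent ?S' x = k *\<^sub>R tangent ?S' y"
      by (auto simp: span_singleton)
    then have "F' q (tangent S x) = F' q (k *\<^sub>R tangent S y)"
      using tangent xy p by (simp add: blinfun.scaleR_right)
    then have "tangent S x = k *\<^sub>R tangent S y" using F(3)[of q] by (simp add: inj_eq)
    then have "tangent S x \<in> span {tangent S y}" by (auto simp: span_singleton)
    then show False using S xy by (auto simp: link_shadow_def)
  qed
  have "immersed_closed_curve g" if "g \<in> set ?S'" for g
    using immersed_closed_curve_comp(1)[OF imm F] that by auto
  moreover have "finite (strands ?S' r) \<and> card (strands ?S' r) \<le> 2" for r
    using S strands surj[of r] by (auto simp: link_shadow_def)
  moreover have "finite (crossings ?S')" unfolding crossings using S by (simp add: link_shadow_def)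
  ultimately show "link_shadow ?S'"
    unfolding link_shadow_def using transverse by blast
qed

text \<open>Resolutions are indexed by points of the plane, hence the inverse of \<open>H 1\<close>.
  A step must end in a link diagram, which is most of the work.\<close>

lemma diagram_equiv_isotopy:
  assumes D: "link_diagram (S, R)" and H: "ambient_isotopy H"
  shows "diagram_equiv (S, R) (map (\<lambda>g. H 1 \<circ> g) S, R \<circ> inv (H 1))" (is "diagram_equiv _ ?D'")
proof -
  obtain H' :: "real \<Rightarrow> complex \<Rightarrow> complex \<Rightarrow>\<^sub>L complex" where
    H': "continuous_on ({0..1} \<times> UNIV) (\<lambda>(t, z). H' t z)"
      "\<And>t z. t \<in> {0..1} \<Longrightarrow> (H t has_derivative blinfun_apply (H' t z)) (at z)"
      "\<And>t z. t \<in> {0..1} \<Longrightarrow> inj (blinfun_apply (H' t z))"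
    and bij: "bij (H 1)"
    using H unfolding ambient_isotopy_def by auto
  have "continuous_on UNIV (\<lambda>z. case (1, z) of (t, z) \<Rightarrow> H' t z)"
    by (rule continuous_on_compose2[OF H'(1)]) (auto intro: continuous_intros)
  then have cont: "continuous_on UNIV (H' 1)" by simp
  have S: "link_shadow S" "dom R = crossings S" "\<And>p x. R p = Some x \<Longrightarrow> x \<in> strands S p"
    using D by (auto simp: link_diagram_def)
  note S' = link_shadow_map_comp[OF S(1) bij H'(2) cont H'(3), simplified]
  have inv: "inv (H 1) (H 1 z) = z" "H 1 (inv (H 1) z) = z" for z
    using bij by (simp_all add: bij_is_inj bij_is_surj surj_f_inv_f)
  have "dom (R \<circ> inv (H 1)) = H 1 ` crossings S"
  proof (intro set_eqI)
    fix p
    have "p \<in> dom (R \<circ> inv (H 1)) \<longleftrightarrow> inv (H 1) p \<in> crossings S"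
      unfolding S(2)[symmetric] by (auto simp: dom_def)
    also have "\<dots> \<longleftrightarrow> p \<in> H 1 ` crossings S"
      using inv by (metis image_iff)
    finally show "p \<in> dom (R \<circ> inv (H 1)) \<longleftrightarrow> p \<in> H 1 ` crossings S" .
  qed
  moreover have "x \<in> strands (map (\<lambda>g. H 1 \<circ> g) S) p" if "(R \<circ> inv (H 1)) p = Some x" for p x
    using S(3)[of "inv (H 1) p" x] that strands_map_comp[OF bij_is_inj[OF bij], of S "inv (H 1) p"]
    by (simp add: inv)
  ultimately have "link_diagram ?D'"
    using S' by (simp add: link_diagram_def)
  moreover have "planar_isotopic (S, R) ?D'"
    unfolding planar_isotopic_def using H by (intro exI[of _ H]) (simp add: inv)
  ultimately have "elementary_step (S, R) ?D'" using D by (simp add: elementary_step_def)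
  then show ?thesis unfolding diagram_equiv_def by (rule r_into_equivclp)
qed

section \<open>Separating the two curves\<close>

lemma closed_curve_image:
  assumes "immersed_closed_curve g"
  shows "compact (range g)" "connected (range g)"
proof -
  have cont: "continuous_on UNIV g"
    using assms by (auto simp: immersed_closed_curve_def intro: C1_differentiable_imp_continuous_on)
  then show "connected (range g)" by (intro connected_continuous_image connected_UNIV)
  have "g t \<in> g ` {0..1}" for t
    using periodic_frac[of g t] assms frac_lt_1[of t]
    by (intro image_eqI[of _ _ "frac t"]) (auto simp: immersed_closed_curve_def)
  then have "range g = g ` {0..1}" by auto
  moreover have "compact (g ` {0..1})"
    using cont by (intro compact_continuous_image) (auto intro: continuous_on_subset)
  ultimately show "compact (range g)" by simp
qed

text \<open>One curve lies in a simply connected open set that misses the other. Shrinking it there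
  fixes the other curve, and the boundary of the small disc splits the result.\<close>

lemma splittable_if_images_disjoint:
  assumes D: "link_diagram (S, R)" and len: "length S = 2"
    and disj: "range (S ! 0) \<inter> range (S ! 1) = {}"
  shows "splittable (S, R)"
proof -
  have curve: "immersed_closed_curve (S ! i)" if "i < 2" for i
    using D that len by (auto simp: link_diagram_def link_shadow_def)
  note K = closed_curve_image[OF curve]
  obtain U where U: "open U" "simply_connected U" and
    cases: "range (S ! 0) \<subseteq> U \<and> U \<inter> range (S ! 1) = {} \<or> range (S ! 1) \<subseteq> U \<and> U \<inter> range (S ! 0) = {}"
    by (rule separating_simply_connected[of "range (S ! 0)" "range (S ! 1)"]) (use K disj in auto)
  obtain i :: nat where i: "i < 2" "range (S ! i) \<subseteq> U" "U \<inter> range (S ! (1 - i)) = {}"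
  proof (cases "range (S ! 0) \<subseteq> U \<and> U \<inter> range (S ! 1) = {}")
    case True
    then show ?thesis by (intro that[of 0]) auto
  next
    case False
    then show ?thesis using cases by (intro that[of 1]) auto
  qed
  \<comment> \<open>The omitted curve is nonempty; the Riemann map requires a proper subset of the
    plane.\<close>
  have "U \<noteq> UNIV" using i(3) by auto
  obtain H p e where H: "ambient_isotopy H" "0 < e" "cball p e \<subseteq> U"
      "H 1 ` range (S ! i) \<subseteq> ball p e" "\<And>t z. z \<notin> U \<Longrightarrow> H t z = z"
    by (rule shrinking_isotopy[OF U \<open>U \<noteq> UNIV\<close> K(1)[OF i(1)] i(2)]) auto
  let ?S' = "map (\<lambda>g. H 1 \<circ> g) S"
  have "split_by_circle ?S'"
    unfolding split_by_circle_def
  proof (intro exI conjI ballI)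
    show "{i} \<noteq> {}" "0 < e" using H(2) by simp_all
    show "{i} \<subset> {..<length ?S'}" using i(1) len by (auto simp: psubset_eq lessThan_Suc numeral_2_eq_2)
    show "range (?S' ! j) \<subseteq> ball p e" if "j \<in> {i}" for j
      using H(4) i(1) that len by (auto simp: image_subset_iff)
    show "range (?S' ! j) \<subseteq> - cball p e" if "j \<in> {..<length ?S'} - {i}" for j
    proof -
      have j: "j = 1 - i" "j < 2" using that i(1) len by auto
      have "(S ! j) t \<notin> U" for t using i(3) j(1) by blast
      then show ?thesis using H(3,5) j(2) len by auto
    qed
  qed
  moreover have "diagram_equiv (S, R) (?S', R \<circ> inv (H 1))" by (rule diagram_equiv_isotopy[OF D H(1)])
  ultimately show ?thesis unfolding splittable_def by fastforce
qed

text \<open>Strands have parameters in \<open>[0, 1)\<close>, so those of a common point are first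
  brought there by \<open>frac\<close>.\<close>

lemma images_disjoint:
  assumes "link_shadow S" "length S = 2" "non_self_intersections S = {}"
  shows "range (S ! 0) \<inter> range (S ! 1) = {}"
proof (rule ccontr)
  assume "\<not> ?thesis"
  then obtain s t where st: "(S ! 0) s = (S ! 1) t" by auto
  have per: "(S ! i) (frac t) = (S ! i) t" if "i < 2" for i t
    using assms that by (intro periodic_frac link_shadow_periodic) auto
  have "(0, frac s) \<in> strands S ((S ! 0) s)" "(1, frac t) \<in> strands S ((S ! 0) s)"
    using assms(2) per st by (auto simp: strands_def lpoints_def proj_def frac_lt_1)
  then have "(S ! 0) s \<in> non_self_intersections S"
    unfolding non_self_intersections_def mem_Collect_eq by (metis fst_conv zero_neq_one)
  then show False using assms(3) by simp
qed

section \<open>The three outcomes of the game\<close>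

theorem theorem1p3:
  fixes S :: shadow
  assumes "link_shadow S" and "length S = 2"
  shows "(card (non_self_intersections S) = 0 \<longrightarrow>
            (\<forall>ms. complete_play S ms \<longrightarrow> wins Unlinker S ms)) \<and>
         (card (non_self_intersections S) \<noteq> 0 \<and> even (card (self_intersections S)) \<longrightarrow>
            (\<exists>\<sigma>. winning_strategy Linker Unlinker S \<sigma>)) \<and>
         (card (non_self_intersections S) \<noteq> 0 \<and> odd (card (self_intersections S)) \<longrightarrow>
            (\<exists>\<sigma>. winning_strategy Linker Linker S \<sigma>))"
proof (intro conjI impI allI; (elim conjE)?)
  fix ms
  assume "card (non_self_intersections S) = 0" and ms: "complete_play S ms"
  then have "non_self_intersections S = {}" using finite_intersections(2)[OF assms(1)] by simp
  then have "splittable (final_diagram S ms)"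
    using splittable_if_images_disjoint images_disjoint assms final_diagram_link_diagram[OF assms(1) ms]
    unfolding final_diagram_def by blast
  then show "wins Unlinker S ms" by simp
next
  assume "card (non_self_intersections S) \<noteq> 0" "even (card (self_intersections S))"
  then show "\<exists>\<sigma>. winning_strategy Linker Unlinker S \<sigma>"
    using linker_strategy_wins_second[OF assms] by force
next
  assume "card (non_self_intersections S) \<noteq> 0" "odd (card (self_intersections S))"
  then show "\<exists>\<sigma>. winning_strategy Linker Linker S \<sigma>"
    using linker_strategy_wins_first[OF assms] by force
qed

end
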